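(* Let $V=L^2(X,\mu_X;\mathbb C)$ with $X=\mathbb Z_2^\infty$ and $\mu_X$ its Haar measure. For any $\gamma\in\Gamma$, the multiplication operators $c_k(x)=\phi_{\gamma^k}(x)$ satisfy $$c_k(x)^*=c_k(x+\delta^k),\qquad c_k(x)c_l(x+\delta^k)=c_l(x)c_k(x+\delta^l)$$ for all $k,l\geq 1$, and therefore $$J_kf(x)=-i\,\phi_{\sigma^{k-1}+\gamma^k}(x)f(x+\delta^k),\qquad J_k'f(x)=\phi_{\sigma^k+\gamma^k}(x)f(x+\delta^k)\qquad(k\ge 1)$$ define a spinor representation on $V$. This representation is irreducible over $\mathbb C$. If $\gamma\in\Gamma_1$ (respectively $\gamma\in\Gamma_{-1}$), then the representation is of real (respectively quaternionic) type, in its respective standard form. Those of real type (with $\gamma\in\Gamma_1$) have $$L^2(X)^{\mathbb R}=\{f\in L^2(X):\overline{f(x)}=f(\check x)\}$$ as the invariant real form.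
   Context: $X=\mathbb Z_2^{\infty}$ is the compact abelian group of sequences $x=(x_1,x_2,\dots)$ of $0$'s and $1$'s with componentwise addition mod $2$. $\delta^k\in X$ has a $1$ in position $k$ and $0$ elsewhere; $\Delta\subset X$ is the subgroup of sequences with finitely many $1$'s. $\check x=x+(1,1,1,\dots)$. For $\alpha\in\Delta$ the Walsh function is $\phi_\alpha(x)=(-1)^{\sum_k\alpha_kx_k}$. $\sigma^k=\delta^1+\dots+\delta^k$, $\sigma^0=0$. $\Gamma$ is the set of infinite symmetric matrices $\gamma=(\gamma^k_j)_{k,j\ge1}$ of $0$'s and $1$'s with only finitely many $1$'s in each row or column and only $0$'s on the diagonal; the row $\gamma^k$ is regarded as a point of $\Delta$. With congruences mod $2$, $\Gamma_1=\{\gamma\in\Gamma:\sum_j\gamma^k_j\equiv k\ \forall k\}$ and $\Gamma_{-1}=\{\gamma\in\Gamma:\sum_j\gamma^1_j\equiv0,\ \sum_j\gamma^k_j\equiv k\ \forall k\ge2\}$. A spinor representation is given by norm-preserving linear operators $J_1,J_1',J_2,J_2',\dots$, each of square $-I$, that pairwise anticommute. Irreducible over $\mathbb C$: no closed complex subspace other than $0,V$ is invariant under all of them. It is of real (resp. quaternionic) type if there is a $\mathbb C$-antilinear norm-preserving operator $S$ (resp. $Q$) on $V$ commuting with all $J_k,J_k'$ with $S^2=I$ (resp. $Q^2=-I$); the invariant real form is $\{f:Sf=f\}$. In the present setting, standard form means: in the real case $\overline{c_k(x)}=(-1)^kc_k(\check x)$ for all $k$ and $Sf(x)=\overline{f(\check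 x)}$; in the quaternionic case $\overline{c_1(x)}=c_1(\check x)$, $\overline{c_k(x)}=(-1)^kc_k(\check x)$ for $k\ge2$, and $Qf(x)=(-1)^{x_1}\overline{f(\check x)}$. *)

theory Defs
  imports
    "HOL-Probability.Probability"
    "HOL-Library.Z2"
    "HOL-Library.Function_Algebras"
    "HOL-Number_Theory.Cong"
begin

section \<open>Spinor representations on complex normed spaces\<close>

text \<open>Generators and coordinates are indexed by the positive integers.\<close>

typedef pos = "{n::nat. 1 \<le> n}"
  morphisms nat_of_pos pos_of_nat
  by auto

instance pos :: countable
  by (rule countable_classI[of nat_of_pos]) (simp add: nat_of_pos_inject)

class scaleC =
  fixes scaleC :: "complex \<Rightarrow> 'a \<Rightarrow> 'a"  (infixr "*\<^sub>C" 75)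

class complex_normed_vector = real_normed_vector + scaleC +
  assumes scaleC_add_right: "a *\<^sub>C (x + y) = a *\<^sub>C x + a *\<^sub>C y"
    and scaleC_add_left: "(a + b) *\<^sub>C x = a *\<^sub>C x + b *\<^sub>C x"
    and scaleC_scaleC: "a *\<^sub>C (b *\<^sub>C x) = (a * b) *\<^sub>C x"
    and scaleC_one: "1 *\<^sub>C x = x"
    and scaleR_scaleC: "r *\<^sub>R x = complex_of_real r *\<^sub>C x"
    and norm_scaleC: "norm (a *\<^sub>C x) = cmod a * norm x"

definition clinear :: "('v::complex_normed_vector \<Rightarrow> 'v) \<Rightarrow> bool" where
  "clinear T \<longleftrightarrow> (\<forall>u v. T (u + v) = T u + T v) \<and> (\<forall>a u. T (a *\<^sub>C u) = a *\<^sub>C T u)"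

definition antilinear :: "('v::complex_normed_vector \<Rightarrow> 'v) \<Rightarrow> bool" where
  "antilinear T \<longleftrightarrow> (\<forall>u v. T (u + v) = T u + T v) \<and> (\<forall>a u. T (a *\<^sub>C u) = cnj a *\<^sub>C T u)"

definition norm_preserving :: "('v::complex_normed_vector \<Rightarrow> 'v) \<Rightarrow> bool" where
  "norm_preserving T \<longleftrightarrow> (\<forall>u. norm (T u) = norm u)"

definition csubspace :: "'v::complex_normed_vector set \<Rightarrow> bool" where
  "csubspace W \<longleftrightarrow> 0 \<in> W \<and> (\<forall>u\<in>W. \<forall>v\<in>W. u + v \<in> W) \<and> (\<forall>a. \<forall>u\<in>W. a *\<^sub>C u \<in> W)"

definition anticommute :: "('v::complex_normed_vector \<Rightarrow> 'v) \<Rightarrow> ('v \<Rightarrow> 'v) \<Rightarrow> bool" where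
  "anticommute S T \<longleftrightarrow> (\<forall>u. S (T u) = - T (S u))"

definition spinor_rep ::
  "(pos \<Rightarrow> 'v::complex_normed_vector \<Rightarrow> 'v) \<Rightarrow> (pos \<Rightarrow> 'v \<Rightarrow> 'v) \<Rightarrow> bool" where
  "spinor_rep J J' \<longleftrightarrow>
     (\<forall>k. clinear (J k) \<and> norm_preserving (J k) \<and> (\<forall>u. J k (J k u) = - u)) \<and>
     (\<forall>k. clinear (J' k) \<and> norm_preserving (J' k) \<and> (\<forall>u. J' k (J' k u) = - u)) \<and>
     (\<forall>k l. k \<noteq> l \<longrightarrow> anticommute (J k) (J l) \<and> anticommute (J' k) (J' l)) \<and>
     (\<forall>k l. anticommute (J k) (J' l))"

definition irreducible_over_C ::
  "(pos \<Rightarrow> 'v::complex_normed_vector \<Rightarrow> 'v) \<Rightarrow> (pos \<Rightarrow> 'v \<Rightarrow> 'v) \<Rightarrow> bool" where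
  "irreducible_over_C J J' \<longleftrightarrow>
     (\<forall>W. csubspace W \<and> closed W \<and> (\<forall>k. J k ` W \<subseteq> W \<and> J' k ` W \<subseteq> W)
          \<longrightarrow> W = {0} \<or> W = UNIV)"

definition commutes_with_rep ::
  "(pos \<Rightarrow> 'v::complex_normed_vector \<Rightarrow> 'v) \<Rightarrow> (pos \<Rightarrow> 'v \<Rightarrow> 'v) \<Rightarrow> ('v \<Rightarrow> 'v) \<Rightarrow> bool" where
  "commutes_with_rep J J' T \<longleftrightarrow> (\<forall>k u. T (J k u) = J k (T u) \<and> T (J' k u) = J' k (T u))"

definition real_structure ::
  "(pos \<Rightarrow> 'v::complex_normed_vector \<Rightarrow> 'v) \<Rightarrow> (pos \<Rightarrow> 'v \<Rightarrow> 'v) \<Rightarrow> ('v \<Rightarrow> 'v) \<Rightarrow> bool" where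
  "real_structure J J' S \<longleftrightarrow>
     antilinear S \<and> norm_preserving S \<and> commutes_with_rep J J' S \<and> (\<forall>u. S (S u) = u)"

definition quaternionic_structure ::
  "(pos \<Rightarrow> 'v::complex_normed_vector \<Rightarrow> 'v) \<Rightarrow> (pos \<Rightarrow> 'v \<Rightarrow> 'v) \<Rightarrow> ('v \<Rightarrow> 'v) \<Rightarrow> bool" where
  "quaternionic_structure J J' Q \<longleftrightarrow>
     antilinear Q \<and> norm_preserving Q \<and> commutes_with_rep J J' Q \<and> (\<forall>u. Q (Q u) = - u)"

definition real_type ::
  "(pos \<Rightarrow> 'v::complex_normed_vector \<Rightarrow> 'v) \<Rightarrow> (pos \<Rightarrow> 'v \<Rightarrow> 'v) \<Rightarrow> bool" where
  "real_type J J' \<longleftrightarrow> (\<exists>S. real_structure J J' S)"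

definition quaternionic_type ::
  "(pos \<Rightarrow> 'v::complex_normed_vector \<Rightarrow> 'v) \<Rightarrow> (pos \<Rightarrow> 'v \<Rightarrow> 'v) \<Rightarrow> bool" where
  "quaternionic_type J J' \<longleftrightarrow> (\<exists>Q. quaternionic_structure J J' Q)"

definition invariant_real_form :: "('v::complex_normed_vector \<Rightarrow> 'v) \<Rightarrow> 'v set" where
  "invariant_real_form S = {u. S u = u}"


section \<open>The group \<open>X\<close> and its Haar measure\<close>

text \<open>Addition on \<open>X\<close> is the pointwise addition of \<^theory>\<open>HOL-Library.Function_Algebras\<close>,
  and its topology is the product of the discrete topologies.\<close>

type_synonym X = "pos \<Rightarrow> bit"

instantiation bit :: discrete_topology
begin
definition open_bit :: "bit set \<Rightarrow> bool" where "open_bit A \<longleftrightarrow> True"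
instance by standard (simp_all add: open_bit_def)
end

lemma UNIV_bit: "(UNIV :: bit set) = {0, 1}"
  by (auto intro: bit.exhaust)

instance bit :: finite
  by standard (simp add: UNIV_bit)

instance bit :: second_countable_topology
proof
  show "\<exists>B::bit set set. countable B \<and> open = generate_topology B"
  proof (intro exI[of _ UNIV] conjI ext)
    show "countable (UNIV :: bit set set)" by (intro countable_finite finite)
    show "open A = generate_topology UNIV A" for A :: "bit set"
      by (auto simp: open_bit_def intro: generate_topology.Basis)
  qed
qed

definition \<delta> :: "pos \<Rightarrow> X" where
  "\<delta> k = (\<lambda>j. if j = k then 1 else 0)"

definition \<sigma> :: "nat \<Rightarrow> X" where
  "\<sigma> n = (\<Sum>k | nat_of_pos k \<le> n. \<delta> k)"

definition \<Delta> :: "X set" where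
  "\<Delta> = {\<alpha>. finite {k. \<alpha> k = 1}}"

definition check :: "X \<Rightarrow> X" where
  "check x = x + (\<lambda>_. 1)"

text \<open>The exponent is the number of \<open>k\<close> with \<open>\<alpha>\<^sub>k x\<^sub>k = 1\<close>, a finite number for \<open>\<alpha> \<in> \<Delta>\<close>.\<close>

definition walsh :: "X \<Rightarrow> X \<Rightarrow> complex" where
  "walsh \<alpha> x = (- 1) ^ card {k. \<alpha> k * x k = 1}"

definition normalized_haar :: "'a::{topological_space, ab_group_add} measure \<Rightarrow> bool" where
  "normalized_haar M \<longleftrightarrow> sets M = sets borel \<and> prob_space M \<and> (\<forall>a. distr M M (\<lambda>x. x + a) = M)"

text \<open>The fair-coin product measure; theorem \<open>normalized_haar_iff\<close> below shows that it is the
  only normalized Haar measure on \<open>X\<close>.\<close>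

definition \<mu>\<^sub>X :: "X measure" where
  "\<mu>\<^sub>X = PiM UNIV (\<lambda>_. uniform_count_measure UNIV)"

lemma sets_mu_X: "sets \<mu>\<^sub>X = sets borel"
proof -
  have "sets (borel :: bit measure) = UNIV"
    using borel_open[of "_ :: bit set"] by (auto simp: open_bit_def)
  then have "sets \<mu>\<^sub>X = sets (PiM UNIV (\<lambda>_::pos. borel :: bit measure))"
    unfolding \<mu>\<^sub>X_def by (intro sets_PiM_cong) auto
  then show ?thesis
    using sets_PiM_equal_borel by simp
qed

lemma space_mu_X [simp]: "space \<mu>\<^sub>X = UNIV"
  using sets_eq_imp_space_eq[OF sets_mu_X] by simp


lemma prob_space_mu_X: "prob_space \<mu>\<^sub>X"
  unfolding \<mu>\<^sub>X_def by (intro prob_space_PiM prob_space_uniform_count_measure) auto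

lemma measurable_add_X:
  "(\<lambda>(x, y). x + y) \<in> measurable (\<mu>\<^sub>X \<Otimes>\<^sub>M \<mu>\<^sub>X) \<mu>\<^sub>X"
proof -
  have "(\<lambda>p k. fst p k + snd p k) \<in> measurable (\<mu>\<^sub>X \<Otimes>\<^sub>M \<mu>\<^sub>X) \<mu>\<^sub>X"
    unfolding \<mu>\<^sub>X_def
  proof (rule measurable_PiM_single')
    fix k :: pos
    let ?U = "uniform_count_measure (UNIV :: bit set)"
    let ?P = "PiM UNIV (\<lambda>_::pos. ?U)"
    have 1: "(\<lambda>p. fst p k) \<in> measurable (?P \<Otimes>\<^sub>M ?P) (count_space UNIV)"
      and 2: "(\<lambda>p. snd p k) \<in> measurable (?P \<Otimes>\<^sub>M ?P) (count_space UNIV)"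
      by (simp_all cong: measurable_cong_sets add: measurable_cong_sets[OF refl sets_uniform_count_measure_count_space[symmetric]])
    have "(\<lambda>p. fst p k + snd p k) \<in> measurable (?P \<Otimes>\<^sub>M ?P) (count_space UNIV)"
      by (rule measurable_compose_countable[OF _ 1])
         (rule measurable_compose[OF 2], simp)
    then show "(\<lambda>p. fst p k + snd p k) \<in> measurable (?P \<Otimes>\<^sub>M ?P) ?U"
      by (simp add: measurable_cong_sets[OF refl sets_uniform_count_measure_count_space])
  qed (auto simp: space_uniform_count_measure)
  then show ?thesis
    by (simp add: case_prod_unfold plus_fun_def)
qed

lemma measurable_translate:
  assumes "sets M = sets \<mu>\<^sub>X"
  shows "(\<lambda>x. x + a) \<in> measurable M M"
proof -
  have "(\<lambda>x. (x, a)) \<in> measurable \<mu>\<^sub>X (\<mu>\<^sub>X \<Otimes>\<^sub>M \<mu>\<^sub>X)"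
    by (rule measurable_Pair) auto
  from measurable_compose[OF this measurable_add_X] show ?thesis
    by (simp add: measurable_cong_sets[OF assms assms])
qed

lemma distr_translate_mu_X: "distr \<mu>\<^sub>X \<mu>\<^sub>X (\<lambda>x. x + a) = \<mu>\<^sub>X"
proof -
  let ?U = "uniform_count_measure (UNIV :: bit set)"
  interpret product_prob_space "\<lambda>_::pos. ?U" UNIV
    by (intro product_prob_spaceI prob_space_uniform_count_measure) auto
  have "distr \<mu>\<^sub>X \<mu>\<^sub>X (\<lambda>x. x + a) = PiM UNIV (\<lambda>_. ?U)"
  proof (rule PiM_eq)
    fix J :: "pos set" and F :: "pos \<Rightarrow> bit set"
    assume J: "finite J"
    let ?G = "\<lambda>j. (\<lambda>b. b + a j) -` F j"
    have sets: "A \<in> sets ?U" for A by simp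
    have inj: "inj_on (\<lambda>b::bit. b + a j) B" for j B
      by (rule inj_onI) (simp only: add_right_cancel)
    have *: "emeasure ?U (?G j) = emeasure ?U (F j)" for j
    proof -
      have "surj (\<lambda>b::bit. b + a j)"
        by (rule finite_UNIV_inj_surj[OF finite inj])
      then have "card (?G j) = card (F j)"
        using card_image[OF inj, of j "?G j"] surj_image_vimage_eq[of "\<lambda>b::bit. b + a j" "F j"]
        by (simp only:)
      then show ?thesis by (simp only: emeasure_uniform_count_measure[OF finite subset_UNIV])
    qed
    have E: "prod_emb UNIV (\<lambda>_. ?U) J (Pi\<^sub>E J F) = {x. \<forall>j\<in>J. x j \<in> F j}"
      by (auto simp: prod_emb_def space_PiM space_uniform_count_measure Pi_iff)
    have "{x. \<forall>j\<in>J. x j \<in> F j} \<in> sets \<mu>\<^sub>X"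
      unfolding \<mu>\<^sub>X_def E[symmetric] using J by (intro sets_PiM_I) auto
    from emeasure_distr[OF measurable_translate[OF refl] this, of a]
    have "emeasure (distr \<mu>\<^sub>X \<mu>\<^sub>X (\<lambda>x. x + a)) (prod_emb UNIV (\<lambda>_. ?U) J (Pi\<^sub>E J F)) =
        emeasure \<mu>\<^sub>X ((\<lambda>x. x + a) -` {x. \<forall>j\<in>J. x j \<in> F j})"
      by (simp only: E space_mu_X Int_UNIV_right)
    also have "(\<lambda>x. x + a) -` {x. \<forall>j\<in>J. x j \<in> F j} =
        {x \<in> space (PiM UNIV (\<lambda>_::pos. ?U)). \<forall>j\<in>J. x j \<in> ?G j}"
      by (simp only: \<mu>\<^sub>X_def[symmetric] space_mu_X vimage_def mem_Collect_eq plus_fun_apply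
          UNIV_I simp_thms)
    also have "emeasure \<mu>\<^sub>X \<dots> = (\<Prod>j\<in>J. emeasure ?U (?G j))"
      unfolding \<mu>\<^sub>X_def by (rule emeasure_PiM_Collect[OF subset_UNIV J sets])
    finally show "emeasure (distr \<mu>\<^sub>X \<mu>\<^sub>X (\<lambda>x. x + a)) (prod_emb UNIV (\<lambda>_. ?U) J (Pi\<^sub>E J F)) =
          (\<Prod>j\<in>J. emeasure ?U (F j))"
      by (simp only: *)
  qed (simp add: \<mu>\<^sub>X_def)
  then show ?thesis by (simp only: \<mu>\<^sub>X_def)
qed

theorem normalized_haar_iff: "normalized_haar M \<longleftrightarrow> M = \<mu>\<^sub>X"
proof
  show "normalized_haar M" if "M = \<mu>\<^sub>X"
    using that by (simp add: normalized_haar_def sets_mu_X prob_space_mu_X distr_translate_mu_X)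
next
  assume M: "normalized_haar M"
  have sM: "sets M = sets \<mu>\<^sub>X" using M by (simp add: normalized_haar_def sets_mu_X)
  interpret M: prob_space M using M by (simp add: normalized_haar_def)
  interpret N: prob_space \<mu>\<^sub>X by (rule prob_space_mu_X)
  interpret pair_sigma_finite M \<mu>\<^sub>X ..
  show "M = \<mu>\<^sub>X"
  proof (rule measure_eqI[OF sM])
    fix A assume "A \<in> sets M"
    then have A: "A \<in> sets \<mu>\<^sub>X" "A \<in> sets M" using sM by auto
    have inv: "(\<integral>\<^sup>+ x. indicator A (x + a) \<partial>K) = emeasure K A"
      if K: "sets K = sets \<mu>\<^sub>X" "distr K K (\<lambda>x. x + a) = K" for K a
    proof -
      have "(\<integral>\<^sup>+ x. indicator A (x + a) \<partial>K) = (\<integral>\<^sup>+ x. indicator A x \<partial>distr K K (\<lambda>x. x + a))"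
        using A K by (intro nn_integral_distr[symmetric] measurable_translate) auto
      then show ?thesis using K A by simp
    qed
    have meas: "(\<lambda>(x, y). indicator A (x + y) :: ennreal) \<in> borel_measurable (M \<Otimes>\<^sub>M \<mu>\<^sub>X)"
      using measurable_compose[OF measurable_add_X, of "indicator A :: X \<Rightarrow> ennreal" borel] A
      by (simp add: case_prod_unfold measurable_cong_sets[OF sets_pair_measure_cong[OF sM refl] refl])
    have "emeasure M A = (\<integral>\<^sup>+ y. (\<integral>\<^sup>+ x. indicator A (x + y) \<partial>M) \<partial>\<mu>\<^sub>X)"
      using M sM by (subst inv) (auto simp: normalized_haar_def N.emeasure_space_1[simplified])
    also have "\<dots> = (\<integral>\<^sup>+ x. (\<integral>\<^sup>+ y. indicator A (y + x) \<partial>\<mu>\<^sub>X) \<partial>M)"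
      using Fubini'[OF meas] by (simp add: add.commute)
    also have "\<dots> = emeasure \<mu>\<^sub>X A"
      by (subst inv) (auto simp: distr_translate_mu_X M.emeasure_space_1)
    finally show "emeasure M A = emeasure \<mu>\<^sub>X A" .
  qed
qed



section \<open>The Hilbert space \<open>L\<^sup>2(X, \<mu>\<^sub>X; \<complex>)\<close>\<close>

definition square_integrable :: "(X \<Rightarrow> complex) \<Rightarrow> bool" where
  "square_integrable f \<longleftrightarrow> f \<in> borel_measurable \<mu>\<^sub>X \<and> integrable \<mu>\<^sub>X (\<lambda>x. (cmod (f x))\<^sup>2)"

definition L2_eq :: "(X \<Rightarrow> complex) \<Rightarrow> (X \<Rightarrow> complex) \<Rightarrow> bool" where
  "L2_eq f g \<longleftrightarrow> square_integrable f \<and> square_integrable g \<and> (AE x in \<mu>\<^sub>X. f x = g x)"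

lemma square_integrable_add:
  assumes "square_integrable f" "square_integrable g"
  shows "square_integrable (\<lambda>x. f x + g x)"
proof -
  have m: "f \<in> borel_measurable \<mu>\<^sub>X" "g \<in> borel_measurable \<mu>\<^sub>X"
    using assms by (auto simp: square_integrable_def)
  have "(cmod (a + b))\<^sup>2 \<le> 2 * (cmod a)\<^sup>2 + 2 * (cmod b)\<^sup>2" for a b
  proof -
    have "(cmod (a + b))\<^sup>2 \<le> (cmod a + cmod b)\<^sup>2"
      by (intro power_mono norm_triangle_ineq) simp
    also have "\<dots> \<le> 2 * (cmod a)\<^sup>2 + 2 * (cmod b)\<^sup>2"
      using sum_squares_bound[of "cmod a" "cmod b"] by (simp add: power2_sum)
    finally show ?thesis .
  qed
  then have "integrable \<mu>\<^sub>X (\<lambda>x. (cmod (f x + g x))\<^sup>2)"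
    using assms m
    by (intro Bochner_Integration.integrable_bound
          [of \<mu>\<^sub>X "\<lambda>x. 2 * (cmod (f x))\<^sup>2 + 2 * (cmod (g x))\<^sup>2" "\<lambda>x. (cmod (f x + g x))\<^sup>2"])
       (auto simp: square_integrable_def)
  then show ?thesis using m by (auto simp: square_integrable_def)
qed

lemma square_integrable_cmult: "square_integrable f \<Longrightarrow> square_integrable (\<lambda>x. a * f x)"
  by (auto simp: square_integrable_def norm_mult power_mult_distrib)

lemma square_integrable_zero: "square_integrable (\<lambda>_. 0)"
  by (simp add: square_integrable_def)

lemma integrable_inner:
  assumes "square_integrable f" "square_integrable g"
  shows "integrable \<mu>\<^sub>X (\<lambda>x. inner (f x) (g x))"
proof -
  have "\<bar>inner a b\<bar> \<le> (cmod a)\<^sup>2 + (cmod b)\<^sup>2" for a b :: complex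
  proof -
    have "\<bar>inner a b\<bar> \<le> cmod a * cmod b"
      by (rule Cauchy_Schwarz_ineq2)
    moreover have "0 \<le> cmod a * cmod b"
      by simp
    ultimately show ?thesis
      using sum_squares_bound[of "cmod a" "cmod b"] by linarith
  qed
  then show ?thesis
    using assms
    by (intro Bochner_Integration.integrable_bound
          [of \<mu>\<^sub>X "\<lambda>x. (cmod (f x))\<^sup>2 + (cmod (g x))\<^sup>2" "\<lambda>x. inner (f x) (g x)"])
       (auto simp: square_integrable_def)
qed

lemma L2_eq_refl: "square_integrable f \<Longrightarrow> (\<And>x. f x = g x) \<Longrightarrow> L2_eq f g"
  by (drule ext[of f g]) (simp add: L2_eq_def)

lemma L2_eq_selfD: "L2_eq f f \<Longrightarrow> square_integrable f"
  by (simp add: L2_eq_def)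

lemmas square_integrable_intros =
  L2_eq_refl square_integrable_add square_integrable_cmult square_integrable_zero

quotient_type L2 = "X \<Rightarrow> complex" / partial: L2_eq
proof (rule part_equivpI)
  show "\<exists>f. L2_eq f f"
    using square_integrable_zero by (auto simp: L2_eq_def)
  show "symp L2_eq"
    by (rule sympI) (auto simp: L2_eq_def)
  show "transp L2_eq"
  proof (rule transpI)
    fix f g h assume *: "L2_eq f g" "L2_eq g h"
    then have "AE x in \<mu>\<^sub>X. f x = g x" "AE x in \<mu>\<^sub>X. g x = h x"
      by (auto simp: L2_eq_def)
    then have "AE x in \<mu>\<^sub>X. f x = h x"
      by eventually_elim simp
    with * show "L2_eq f h" by (auto simp: L2_eq_def)
  qed
qed

text \<open>The inner product is the real part of the Hermitian one; it induces the usual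
  \<open>L\<^sup>2\<close> norm.\<close>

instantiation L2 :: real_inner
begin

lift_definition zero_L2 :: L2 is "\<lambda>_. 0"
  using square_integrable_zero by (simp add: L2_eq_def)

lift_definition plus_L2 :: "L2 \<Rightarrow> L2 \<Rightarrow> L2" is "\<lambda>f g x. f x + g x"
proof -
  fix f f' g g' assume *: "L2_eq f f'" "L2_eq g g'"
  then have "AE x in \<mu>\<^sub>X. f x = f' x" "AE x in \<mu>\<^sub>X. g x = g' x"
    by (auto simp: L2_eq_def)
  then have "AE x in \<mu>\<^sub>X. f x + g x = f' x + g' x"
    by eventually_elim simp
  with * show "L2_eq (\<lambda>x. f x + g x) (\<lambda>x. f' x + g' x)"
    by (simp add: L2_eq_def square_integrable_add)
qed

lift_definition uminus_L2 :: "L2 \<Rightarrow> L2" is "\<lambda>f x. - f x"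
  using square_integrable_cmult[of _ "-1"] by (auto simp: L2_eq_def)

lift_definition scaleR_L2 :: "real \<Rightarrow> L2 \<Rightarrow> L2" is "\<lambda>r f x. complex_of_real r * f x"
  using square_integrable_cmult by (auto simp: L2_eq_def elim: eventually_mono)

lift_definition inner_L2 :: "L2 \<Rightarrow> L2 \<Rightarrow> real" is "\<lambda>f g. \<integral>x. inner (f x) (g x) \<partial>\<mu>\<^sub>X"
proof -
  fix f f' g g' assume *: "L2_eq f f'" "L2_eq g g'"
  then have "AE x in \<mu>\<^sub>X. f x = f' x" "AE x in \<mu>\<^sub>X. g x = g' x"
    by (auto simp: L2_eq_def)
  then have "AE x in \<mu>\<^sub>X. inner (f x) (g x) = inner (f' x) (g' x)"
    by eventually_elim simp
  with * show "(\<integral>x. inner (f x) (g x) \<partial>\<mu>\<^sub>X) = (\<integral>x. inner (f' x) (g' x) \<partial>\<mu>\<^sub>X)"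
    by (intro integral_cong_AE) (auto simp: L2_eq_def square_integrable_def)
qed

lift_definition norm_L2 :: "L2 \<Rightarrow> real" is "\<lambda>f. sqrt (\<integral>x. (cmod (f x))\<^sup>2 \<partial>\<mu>\<^sub>X)"
proof -
  fix f g assume *: "L2_eq f g"
  then have "AE x in \<mu>\<^sub>X. (cmod (f x))\<^sup>2 = (cmod (g x))\<^sup>2"
    by (auto simp: L2_eq_def elim: eventually_mono)
  with * have "(\<integral>x. (cmod (f x))\<^sup>2 \<partial>\<mu>\<^sub>X) = (\<integral>x. (cmod (g x))\<^sup>2 \<partial>\<mu>\<^sub>X)"
    by (intro integral_cong_AE) (auto simp: L2_eq_def square_integrable_def)
  then show "sqrt (\<integral>x. (cmod (f x))\<^sup>2 \<partial>\<mu>\<^sub>X) = sqrt (\<integral>x. (cmod (g x))\<^sup>2 \<partial>\<mu>\<^sub>X)"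
    by simp
qed

definition minus_L2 :: "L2 \<Rightarrow> L2 \<Rightarrow> L2" where "minus_L2 u v = u + - v"
definition dist_L2 :: "L2 \<Rightarrow> L2 \<Rightarrow> real" where "dist_L2 u v = norm (u - v)"
definition sgn_L2 :: "L2 \<Rightarrow> L2" where "sgn_L2 u = inverse (norm u) *\<^sub>R u"
definition uniformity_L2 :: "(L2 \<times> L2) filter" where
  "uniformity_L2 = (INF e\<in>{0<..}. principal {(u, v). dist u v < e})"
definition open_L2 :: "L2 set \<Rightarrow> bool" where
  "open_L2 U \<longleftrightarrow> (\<forall>u\<in>U. \<forall>\<^sub>F (u', v) in uniformity. u' = u \<longrightarrow> v \<in> U)"

instance
proof
  fix u v w :: L2 and r s :: real
  show "u + v + w = u + (v + w)"
    by transfer (auto intro!: square_integrable_intros dest!: L2_eq_selfD simp: algebra_simps)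
  show "u + v = v + u"
    by transfer (auto intro!: square_integrable_intros dest!: L2_eq_selfD simp: algebra_simps)
  show "0 + u = u"
    by transfer (auto intro!: square_integrable_intros dest!: L2_eq_selfD)
  show "- u + u = 0"
    by transfer (auto intro!: square_integrable_intros dest!: L2_eq_selfD simp: algebra_simps)
  show "u - v = u + - v"
    by (rule minus_L2_def)
  show "r *\<^sub>R (u + v) = r *\<^sub>R u + r *\<^sub>R v"
    by transfer (auto intro!: square_integrable_intros dest!: L2_eq_selfD simp: distrib_left)
  show "(r + s) *\<^sub>R u = r *\<^sub>R u + s *\<^sub>R u"
    by transfer (auto intro!: square_integrable_intros dest!: L2_eq_selfD simp: distrib_right)
  show "r *\<^sub>R s *\<^sub>R u = (r * s) *\<^sub>R u"
    by transfer (auto intro!: square_integrable_intros dest!: L2_eq_selfD simp: mult.assoc)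
  show "1 *\<^sub>R u = u"
    by transfer (auto intro!: square_integrable_intros dest!: L2_eq_selfD)
  show "dist u v = norm (u - v)"
    by (rule dist_L2_def)
  show "sgn u = inverse (norm u) *\<^sub>R u"
    by (rule sgn_L2_def)
  show "uniformity = (INF e\<in>{0<..}. principal {(u :: L2, v). dist u v < e})"
    by (rule uniformity_L2_def)
  show "open U \<longleftrightarrow> (\<forall>u\<in>U. \<forall>\<^sub>F (u', v) in uniformity. u' = u \<longrightarrow> v \<in> U)" for U :: "L2 set"
    by (rule open_L2_def)
  show "inner u v = inner v u"
    by transfer (simp add: inner_commute)
  show "inner (u + v) w = inner u w + inner v w"
    by transfer (auto dest!: L2_eq_selfD simp: inner_add_left integrable_inner)
  show "inner (r *\<^sub>R u) v = r * inner u v"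
    by transfer (auto simp: inner_mult_left scaleR_conv_of_real[symmetric])
  show "0 \<le> inner u u"
    by transfer simp
  show "inner u u = 0 \<longleftrightarrow> u = 0"
  proof transfer
    fix f assume "L2_eq f f"
    then have f: "square_integrable f" by (simp add: L2_eq_def)
    have "(\<integral>x. inner (f x) (f x) \<partial>\<mu>\<^sub>X) = 0 \<longleftrightarrow> (AE x in \<mu>\<^sub>X. inner (f x) (f x) = 0)"
      by (rule integral_nonneg_eq_0_iff_AE[OF integrable_inner[OF f f]]) simp
    then show "(\<integral>x. inner (f x) (f x) \<partial>\<mu>\<^sub>X) = 0 \<longleftrightarrow> L2_eq f (\<lambda>_. 0)"
      using f square_integrable_zero by (simp add: L2_eq_def)
  qed
  show "norm u = sqrt (inner u u)"
    by transfer (simp add: power2_norm_eq_inner)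
qed

end

instantiation L2 :: complex_normed_vector
begin

lift_definition scaleC_L2 :: "complex \<Rightarrow> L2 \<Rightarrow> L2" is "\<lambda>a f x. a * f x"
  using square_integrable_cmult by (auto simp: L2_eq_def elim: eventually_mono)

instance
proof
  fix u v :: L2 and a b :: complex and r :: real
  show "a *\<^sub>C (u + v) = a *\<^sub>C u + a *\<^sub>C v"
    by transfer (auto intro!: square_integrable_intros dest!: L2_eq_selfD simp: algebra_simps)
  show "(a + b) *\<^sub>C u = a *\<^sub>C u + b *\<^sub>C u"
    by transfer (auto intro!: square_integrable_intros dest!: L2_eq_selfD simp: algebra_simps)
  show "a *\<^sub>C b *\<^sub>C u = (a * b) *\<^sub>C u"
    by transfer (auto intro!: square_integrable_intros dest!: L2_eq_selfD simp: algebra_simps)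
  show "1 *\<^sub>C u = u"
    by transfer (auto intro!: square_integrable_intros dest!: L2_eq_selfD)
  show "r *\<^sub>R u = complex_of_real r *\<^sub>C u"
    by transfer (auto intro!: square_integrable_intros dest!: L2_eq_selfD)
  show "norm (a *\<^sub>C u) = cmod a * norm u"
    by transfer (simp add: norm_mult power_mult_distrib real_sqrt_mult)
qed

end


section \<open>The operators defined by a matrix \<open>\<gamma>\<close>\<close>

instantiation pos :: one
begin
definition one_pos :: pos where "1 = pos_of_nat 1"
instance ..
end

definition \<Gamma> :: "(pos \<Rightarrow> pos \<Rightarrow> bit) set" where
  "\<Gamma> = {\<gamma>. (\<forall>k j. \<gamma> k j = \<gamma> j k) \<and> (\<forall>k. finite {j. \<gamma> k j = 1}) \<and>
           (\<forall>j. finite {k. \<gamma> k j = 1}) \<and> (\<forall>k. \<gamma> k k = 0)}"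

definition \<Gamma>\<^sub>1 :: "(pos \<Rightarrow> pos \<Rightarrow> bit) set" where
  "\<Gamma>\<^sub>1 = {\<gamma> \<in> \<Gamma>. \<forall>k. [card {j. \<gamma> k j = 1} = nat_of_pos k] (mod 2)}"

text \<open>\<open>\<Gamma>\<^sub>m\<^sub>1\<close> is the set with index \<open>-1\<close>.\<close>

definition \<Gamma>\<^sub>m\<^sub>1 :: "(pos \<Rightarrow> pos \<Rightarrow> bit) set" where
  "\<Gamma>\<^sub>m\<^sub>1 = {\<gamma> \<in> \<Gamma>. [card {j. \<gamma> 1 j = 1} = 0] (mod 2) \<and>
             (\<forall>k. nat_of_pos k \<ge> 2 \<longrightarrow> [card {j. \<gamma> k j = 1} = nat_of_pos k] (mod 2))}"

definition c_mult :: "(pos \<Rightarrow> pos \<Rightarrow> bit) \<Rightarrow> pos \<Rightarrow> X \<Rightarrow> complex" where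
  "c_mult \<gamma> k x = walsh (\<gamma> k) x"

text \<open>Each operator below applies its formula to a chosen representative of the argument;
  the lemmas \<open>J_op_abs_L2\<close>, \<open>J'_op_abs_L2\<close>, \<open>S_op_abs_L2\<close>, \<open>Q_op_abs_L2\<close>, \<open>L2_real_abs_L2\<close> show
  that every representative gives the same result.\<close>

definition J_op :: "(pos \<Rightarrow> pos \<Rightarrow> bit) \<Rightarrow> pos \<Rightarrow> L2 \<Rightarrow> L2" where
  "J_op \<gamma> k u = abs_L2 (\<lambda>x. - \<i> * walsh (\<sigma> (nat_of_pos k - 1) + \<gamma> k) x * rep_L2 u (x + \<delta> k))"

definition J'_op :: "(pos \<Rightarrow> pos \<Rightarrow> bit) \<Rightarrow> pos \<Rightarrow> L2 \<Rightarrow> L2" where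
  "J'_op \<gamma> k u = abs_L2 (\<lambda>x. walsh (\<sigma> (nat_of_pos k) + \<gamma> k) x * rep_L2 u (x + \<delta> k))"

definition S_op :: "L2 \<Rightarrow> L2" where
  "S_op u = abs_L2 (\<lambda>x. cnj (rep_L2 u (check x)))"

definition Q_op :: "L2 \<Rightarrow> L2" where
  "Q_op u = abs_L2 (\<lambda>x. (if x 1 = 1 then - 1 else 1) * cnj (rep_L2 u (check x)))"

definition L2_real :: "L2 set" where
  "L2_real = {u. AE x in \<mu>\<^sub>X. cnj (rep_L2 u x) = rep_L2 u (check x)}"

lemma rep_abs_L2:
  assumes "square_integrable f"
  shows "square_integrable (rep_L2 (abs_L2 f))" and "AE x in \<mu>\<^sub>X. rep_L2 (abs_L2 f) x = f x"
  using Quotient3_rep_abs[OF Quotient3_L2, of f] assms by (auto simp: L2_eq_def)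

lemma AE_translate: "AE x in \<mu>\<^sub>X. P x \<Longrightarrow> AE x in \<mu>\<^sub>X. P (x + a)"
  by (rule AE_distrD[OF measurable_translate[OF refl]]) (simp only: distr_translate_mu_X)

lemma square_integrable_translate:
  assumes "square_integrable f"
  shows "square_integrable (\<lambda>x. f (x + a))"
proof -
  have "f \<in> borel_measurable \<mu>\<^sub>X" "integrable (distr \<mu>\<^sub>X \<mu>\<^sub>X (\<lambda>x. x + a)) (\<lambda>x. (cmod (f x))\<^sup>2)"
    using assms by (simp_all add: square_integrable_def distr_translate_mu_X)
  then show ?thesis
    unfolding square_integrable_def
    by (intro conjI measurable_compose[OF measurable_translate[OF refl]]
        integrable_distr[OF measurable_translate[OF refl]])
qed

lemma square_integrable_weight:
  assumes "square_integrable f" "w \<in> borel_measurable \<mu>\<^sub>X" "\<And>x. cmod (w x) = 1"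
  shows "square_integrable (\<lambda>x. w x * f x)"
  using assms by (auto simp: square_integrable_def norm_mult)

lemma abs_L2_weighted_translate:
  assumes f: "square_integrable f"
    and w: "w \<in> borel_measurable \<mu>\<^sub>X" "\<And>x. cmod (w x) = 1"
  shows "abs_L2 (\<lambda>x. w x * rep_L2 (abs_L2 f) (x + a)) = abs_L2 (\<lambda>x. w x * f (x + a))"
proof (rule Quotient3_rel_abs[OF Quotient3_L2])
  have "AE x in \<mu>\<^sub>X. rep_L2 (abs_L2 f) (x + a) = f (x + a)"
    by (rule AE_translate[OF rep_abs_L2(2)[OF f]])
  then have "AE x in \<mu>\<^sub>X. w x * rep_L2 (abs_L2 f) (x + a) = w x * f (x + a)"
    by eventually_elim (simp only:)
  then show "L2_eq (\<lambda>x. w x * rep_L2 (abs_L2 f) (x + a)) (\<lambda>x. w x * f (x + a))"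
    unfolding L2_eq_def
    by (intro conjI square_integrable_weight square_integrable_translate rep_abs_L2(1) f w)
qed

lemma abs_L2_weighted_cnj_translate:
  assumes f: "square_integrable f"
    and w: "w \<in> borel_measurable \<mu>\<^sub>X" "\<And>x. cmod (w x) = 1"
  shows "abs_L2 (\<lambda>x. w x * cnj (rep_L2 (abs_L2 f) (x + a))) = abs_L2 (\<lambda>x. w x * cnj (f (x + a)))"
proof (rule Quotient3_rel_abs[OF Quotient3_L2])
  have cnj: "square_integrable (\<lambda>x. cnj (g x))" if "square_integrable g" for g
    using that by (auto simp: square_integrable_def
        intro: measurable_compose[OF _ borel_measurable_continuous_onI[OF continuous_on_cnj[OF continuous_on_id]]])
  have "AE x in \<mu>\<^sub>X. rep_L2 (abs_L2 f) (x + a) = f (x + a)"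
    by (rule AE_translate[OF rep_abs_L2(2)[OF f]])
  then have "AE x in \<mu>\<^sub>X. w x * cnj (rep_L2 (abs_L2 f) (x + a)) = w x * cnj (f (x + a))"
    by eventually_elim (simp only:)
  then show "L2_eq (\<lambda>x. w x * cnj (rep_L2 (abs_L2 f) (x + a))) (\<lambda>x. w x * cnj (f (x + a)))"
    unfolding L2_eq_def
    by (intro conjI square_integrable_weight cnj square_integrable_translate rep_abs_L2(1) f w)
qed

lemma cmod_walsh: "cmod (walsh \<alpha> x) = 1"
  by (simp add: walsh_def norm_power)

lemma measurable_coordinate: "(\<lambda>x. x k) \<in> measurable \<mu>\<^sub>X (count_space UNIV)"
  unfolding \<mu>\<^sub>X_def
  by (simp add: measurable_cong_sets[OF refl sets_uniform_count_measure_count_space[symmetric]])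

lemma measurable_sign: "(\<lambda>x. if x k = 1 then - 1 else 1 :: complex) \<in> borel_measurable \<mu>\<^sub>X"
  by (rule measurable_compose[OF measurable_coordinate]) simp

lemma measurable_walsh:
  assumes "\<alpha> \<in> \<Delta>"
  shows "walsh \<alpha> \<in> borel_measurable \<mu>\<^sub>X"
proof -
  have fin: "finite {k. \<alpha> k = 1}" using assms by (simp add: \<Delta>_def)
  have "walsh \<alpha> x = (\<Prod>k | \<alpha> k = 1. if x k = 1 then - 1 else 1)" for x
  proof -
    have "{k. \<alpha> k * x k = 1} = {k \<in> {k. \<alpha> k = 1}. x k = 1}"
      by (rule Collect_cong) (case_tac "\<alpha> k", simp_all)
    then show ?thesis
      unfolding walsh_def by (simp only: prod.inter_filter[OF fin, symmetric] prod_constant)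
  qed
  then have "walsh \<alpha> = (\<lambda>x. \<Prod>k | \<alpha> k = 1. if x k = 1 then - 1 else 1)" by (rule ext)
  moreover have "\<dots> \<in> borel_measurable \<mu>\<^sub>X"
    by (rule borel_measurable_prod) (rule measurable_sign)
  ultimately show ?thesis by (simp only:)
qed

lemma sum_fun_at: "(\<Sum>k\<in>A. f k) j = (\<Sum>k\<in>A. f k j)"
  for f :: "'i \<Rightarrow> 'a \<Rightarrow> 'b::comm_monoid_add"
  by (induction A rule: infinite_finite_induct) simp_all

lemma finite_pos_le: "finite {k. nat_of_pos k \<le> n}"
  by (rule finite_imageD[OF finite_subset[of _ "{..n}"]]) (auto simp: inj_on_def nat_of_pos_inject)

lemma sigma_apply: "\<sigma> n j = (if nat_of_pos j \<le> n then 1 else 0)"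
proof -
  have "\<sigma> n j = (\<Sum>k | nat_of_pos k \<le> n. if j = k then 1 else 0)"
    unfolding \<sigma>_def sum_fun_at \<delta>_def ..
  then show ?thesis by (simp only: sum.delta'[OF finite_pos_le] sum.delta[OF finite_pos_le] mem_Collect_eq)
qed

lemma sigma_add_row_in_Delta:
  assumes "\<gamma> \<in> \<Gamma>"
  shows "\<sigma> n + \<gamma> k \<in> \<Delta>"
proof -
  have "{j. (\<sigma> n + \<gamma> k) j = 1} \<subseteq> {j. nat_of_pos j \<le> n} \<union> {j. \<gamma> k j = 1}"
    by (auto simp: sigma_apply split: if_splits)
  then show ?thesis
    using assms finite_pos_le unfolding \<Delta>_def \<Gamma>_def
    by (auto intro: finite_subset)
qed

lemma J_op_abs_L2:
  assumes "\<gamma> \<in> \<Gamma>" "square_integrable f"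
  shows "J_op \<gamma> k (abs_L2 f) =
    abs_L2 (\<lambda>x. - \<i> * walsh (\<sigma> (nat_of_pos k - 1) + \<gamma> k) x * f (x + \<delta> k))"
  unfolding J_op_def
  by (rule abs_L2_weighted_translate[OF assms(2)])
     (auto simp: norm_mult cmod_walsh intro!: borel_measurable_times
       measurable_walsh sigma_add_row_in_Delta assms(1))

lemma J'_op_abs_L2:
  assumes "\<gamma> \<in> \<Gamma>" "square_integrable f"
  shows "J'_op \<gamma> k (abs_L2 f) =
    abs_L2 (\<lambda>x. walsh (\<sigma> (nat_of_pos k) + \<gamma> k) x * f (x + \<delta> k))"
  unfolding J'_op_def
  by (rule abs_L2_weighted_translate[OF assms(2)])
     (auto simp: cmod_walsh intro!: measurable_walsh sigma_add_row_in_Delta assms(1))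

lemma S_op_abs_L2:
  assumes "square_integrable f"
  shows "S_op (abs_L2 f) = abs_L2 (\<lambda>x. cnj (f (check x)))"
  unfolding S_op_def check_def
  using abs_L2_weighted_cnj_translate[OF assms, of "\<lambda>_. 1"] by simp

lemma Q_op_abs_L2:
  assumes "square_integrable f"
  shows "Q_op (abs_L2 f) = abs_L2 (\<lambda>x. (if x 1 = 1 then - 1 else 1) * cnj (f (check x)))"
  unfolding Q_op_def check_def
  by (rule abs_L2_weighted_cnj_translate[OF assms measurable_sign]) simp

lemma L2_real_abs_L2:
  assumes "square_integrable f"
  shows "abs_L2 f \<in> L2_real \<longleftrightarrow> (AE x in \<mu>\<^sub>X. cnj (f x) = f (check x))"
proof -
  note 1 = rep_abs_L2(2)[OF assms]
  note 2 = AE_translate[OF 1, of "\<lambda>_. 1", folded check_def]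
  from 1 2 have "AE x in \<mu>\<^sub>X. cnj (rep_L2 (abs_L2 f) x) = rep_L2 (abs_L2 f) (check x) \<longleftrightarrow>
      cnj (f x) = f (check x)"
    by eventually_elim (simp only:)
  then show ?thesis
    unfolding L2_real_def mem_Collect_eq by (rule eventually_subst)
qed

end

theory Submission
  imports Defs
begin

text \<open>
  All operators in sight are weighted translations \<open>f \<mapsto> w(x) f(x + a)\<close> or their antilinear
  analogues, with \<open>w\<close> a multiple of a Walsh function, so the spinor relations and the real and
  quaternionic structures reduce to the bicharacter identities for \<open>\<phi>\<^sub>\<alpha>(x)\<close>.

  For irreducibility, \<open>J\<^sub>k J'\<^sub>k\<close> is \<open>\<i>\<close> times multiplication by \<open>\<phi>\<close> at \<open>\<delta>\<^sup>k\<close>, so an invariant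
  subspace \<open>W\<close> is stable under multiplication by every Walsh function, hence also under every
  translation by \<open>\<delta>\<^sup>k\<close>. Averaging over translations of the first \<open>n\<close> coordinates sends \<open>v\<close> to its
  mean as \<open>n \<rightarrow> \<infinity>\<close>: this is clear for Walsh functions, whose span is dense. If \<open>u \<noteq> 0\<close> lies in a
  closed such \<open>W\<close>, some \<open>\<phi>\<^sub>\<alpha> u\<close> has nonzero mean, so \<open>W\<close> contains the constants, then all Walsh
  functions, then everything. No completeness of \<open>L\<^sup>2\<close> is used.
\<close>

section \<open>Weighted translations of \<open>L\<^sup>2(X)\<close>\<close>

lemma square_integrable_rep_L2: "square_integrable (rep_L2 u)"
  using Quotient3_rep_reflp[OF Quotient3_L2, of u] by (simp add: L2_eq_def)

lemma abs_rep_L2: "abs_L2 (rep_L2 u) = u"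
  by (rule Quotient3_abs_rep[OF Quotient3_L2])

text \<open>The operators act through \<open>rep_L2\<close>. Writing a vector as the class of an
  arbitrary function trades that choice for explicit formulas.\<close>

lemma L2_cases:
  obtains f where "square_integrable f" "u = abs_L2 f"
  using square_integrable_rep_L2 abs_rep_L2 by metis

lemma abs_L2_eq_iff:
  assumes "square_integrable f" "square_integrable g"
  shows "abs_L2 f = abs_L2 g \<longleftrightarrow> (AE x in \<mu>\<^sub>X. f x = g x)"
  using Quotient3_rel[OF Quotient3_L2, of f g] assms by (simp add: L2_eq_def)

lemma L2_eq_same: "square_integrable f \<Longrightarrow> L2_eq f f"
  by (simp add: L2_eq_def)

lemma abs_L2_add:
  "square_integrable f \<Longrightarrow> square_integrable g \<Longrightarrow> abs_L2 f + abs_L2 g = abs_L2 (\<lambda>x. f x + g x)"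
  by (simp add: plus_L2.abs_eq L2_eq_same)

lemma abs_L2_scaleC: "square_integrable f \<Longrightarrow> a *\<^sub>C abs_L2 f = abs_L2 (\<lambda>x. a * f x)"
  by (simp add: scaleC_L2.abs_eq L2_eq_same)

lemma abs_L2_uminus: "square_integrable f \<Longrightarrow> - abs_L2 f = abs_L2 (\<lambda>x. - f x)"
  by (simp add: uminus_L2.abs_eq L2_eq_same)

lemma abs_L2_diff:
  assumes "square_integrable f" "square_integrable g"
  shows "abs_L2 f - abs_L2 g = abs_L2 (\<lambda>x. f x - g x)"
  using assms square_integrable_cmult[OF assms(2), of "-1"]
  by (simp add: minus_L2_def abs_L2_uminus abs_L2_add)

lemma norm_abs_L2: "square_integrable f \<Longrightarrow> norm (abs_L2 f) = sqrt (\<integral>x. (cmod (f x))\<^sup>2 \<partial>\<mu>\<^sub>X)"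
  by (simp add: norm_L2.abs_eq L2_eq_same)

lemma square_integrable_cnj: "square_integrable f \<Longrightarrow> square_integrable (\<lambda>x. cnj (f x))"
  by (auto simp: square_integrable_def
      intro: measurable_compose[OF _ borel_measurable_continuous_onI[OF continuous_on_cnj[OF continuous_on_id]]])

section \<open>Isometric weighted translations and their composition laws\<close>

definition unimodular :: "(X \<Rightarrow> complex) \<Rightarrow> bool" where
  "unimodular w \<longleftrightarrow> w \<in> borel_measurable \<mu>\<^sub>X \<and> (\<forall>x. cmod (w x) = 1)"

text \<open>The body has the shape of \<open>J_op\<close> and \<open>J'_op\<close>, so these are
  instances by mere unfolding; \<open>cshift\<close> below plays the same role for
  \<open>S_op\<close> and \<open>Q_op\<close>.\<close>

definition wshift :: "(X \<Rightarrow> complex) \<Rightarrow> X \<Rightarrow> L2 \<Rightarrow> L2" where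
  "wshift w a u = abs_L2 (\<lambda>x. w x * rep_L2 u (x + a))"

definition cshift :: "(X \<Rightarrow> complex) \<Rightarrow> X \<Rightarrow> L2 \<Rightarrow> L2" where
  "cshift w a u = abs_L2 (\<lambda>x. w x * cnj (rep_L2 u (x + a)))"

lemma unimodular_const: "cmod z = 1 \<Longrightarrow> unimodular (\<lambda>_. z)"
  by (simp add: unimodular_def)

lemma unimodular_mult: "unimodular v \<Longrightarrow> unimodular w \<Longrightarrow> unimodular (\<lambda>x. v x * w x)"
  by (auto simp: unimodular_def norm_mult)

lemma unimodular_translate: "unimodular w \<Longrightarrow> unimodular (\<lambda>x. w (x + a))"
  by (auto simp: unimodular_def intro: measurable_compose[OF measurable_translate[OF refl]])

lemma square_integrable_unimodular: "unimodular w \<Longrightarrow> square_integrable w"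
  using prob_space_mu_X
  by (auto simp: unimodular_def square_integrable_def intro: prob_space.finite_measure
      finite_measure.integrable_const)

lemma square_integrable_wshift:
  "unimodular w \<Longrightarrow> square_integrable f \<Longrightarrow> square_integrable (\<lambda>x. w x * f (x + a))"
  by (auto simp: unimodular_def intro!: square_integrable_weight square_integrable_translate)

lemma square_integrable_cshift:
  "unimodular w \<Longrightarrow> square_integrable f \<Longrightarrow> square_integrable (\<lambda>x. w x * cnj (f (x + a)))"
  by (rule square_integrable_wshift[OF _ square_integrable_cnj])

lemma unimodular_cmod: "unimodular w \<Longrightarrow> cmod (w x) = 1"
  by (simp add: unimodular_def)

lemma wshift_abs_L2:
  "unimodular w \<Longrightarrow> square_integrable f \<Longrightarrow> wshift w a (abs_L2 f) = abs_L2 (\<lambda>x. w x * f (x + a))"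
  unfolding wshift_def unimodular_def by (rule abs_L2_weighted_translate) auto

lemma cshift_abs_L2:
  "unimodular w \<Longrightarrow> square_integrable f \<Longrightarrow> cshift w a (abs_L2 f) = abs_L2 (\<lambda>x. w x * cnj (f (x + a)))"
  unfolding cshift_def unimodular_def by (rule abs_L2_weighted_cnj_translate) auto

lemma integral_translate:
  assumes "square_integrable f"
  shows "(\<integral>x. (cmod (f (x + a)))\<^sup>2 \<partial>\<mu>\<^sub>X) = (\<integral>x. (cmod (f x))\<^sup>2 \<partial>\<mu>\<^sub>X)"
proof -
  have "(\<lambda>x. (cmod (f x))\<^sup>2) \<in> borel_measurable \<mu>\<^sub>X"
    using assms by (auto simp: square_integrable_def)
  from integral_distr[OF measurable_translate[OF refl] this, of a] show ?thesis
    by (simp add: distr_translate_mu_X)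
qed

lemma norm_wshift: "unimodular w \<Longrightarrow> norm (wshift w a u) = norm u"
  by (cases u rule: L2_cases)
    (simp add: wshift_abs_L2 norm_abs_L2 square_integrable_wshift norm_mult unimodular_cmod
      integral_translate)

lemma norm_cshift: "unimodular w \<Longrightarrow> norm (cshift w a u) = norm u"
  by (cases u rule: L2_cases)
    (simp add: cshift_abs_L2 norm_abs_L2 square_integrable_cshift norm_mult
      unimodular_cmod integral_translate)

lemma clinear_wshift: "unimodular w \<Longrightarrow> clinear (wshift w a)"
  unfolding clinear_def
proof (intro conjI allI)
  fix u v z assume w: "unimodular w"
  obtain f g where f: "square_integrable f" "u = abs_L2 f" and g: "square_integrable g" "v = abs_L2 g"
    by (metis L2_cases)
  show "wshift w a (u + v) = wshift w a u + wshift w a v"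
    using f g w by (simp add: abs_L2_add wshift_abs_L2 square_integrable_add square_integrable_wshift algebra_simps)
  show "wshift w a (z *\<^sub>C u) = z *\<^sub>C wshift w a u"
    using f w by (simp add: abs_L2_scaleC wshift_abs_L2 square_integrable_cmult square_integrable_wshift algebra_simps)
qed

lemma antilinear_cshift: "unimodular w \<Longrightarrow> antilinear (cshift w a)"
  unfolding antilinear_def
proof (intro conjI allI)
  fix u v z assume w: "unimodular w"
  obtain f g where f: "square_integrable f" "u = abs_L2 f" and g: "square_integrable g" "v = abs_L2 g"
    by (metis L2_cases)
  show "cshift w a (u + v) = cshift w a u + cshift w a v"
    using f g w by (simp add: abs_L2_add cshift_abs_L2 square_integrable_add square_integrable_cshift
        algebra_simps)
  show "cshift w a (z *\<^sub>C u) = cnj z *\<^sub>C cshift w a u"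
    using f w by (simp add: abs_L2_scaleC cshift_abs_L2 square_integrable_cmult square_integrable_cshift
        algebra_simps)
qed

text \<open>The inner weight is evaluated after the outer translation. This law and its three
  variants with \<open>cshift\<close> reduce operator identities to pointwise identities between
  weights.\<close>

lemma wshift_wshift:
  "unimodular v \<Longrightarrow> unimodular w \<Longrightarrow>
    wshift v a (wshift w b u) = wshift (\<lambda>x. v x * w (x + a)) (a + b) u"
  by (cases u rule: L2_cases)
    (simp add: wshift_abs_L2 square_integrable_wshift unimodular_mult unimodular_translate mult.assoc add.assoc)

lemma wshift_cshift:
  "unimodular v \<Longrightarrow> unimodular w \<Longrightarrow>
    wshift v a (cshift w b u) = cshift (\<lambda>x. v x * w (x + a)) (a + b) u"
  by (cases u rule: L2_cases)
    (simp add: wshift_abs_L2 cshift_abs_L2 square_integrable_wshift square_integrable_cshift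
      unimodular_mult unimodular_translate mult.assoc add.assoc)

lemma unimodular_cnj: "unimodular w \<Longrightarrow> unimodular (\<lambda>x. cnj (w x))"
  using square_integrable_cnj[of w] square_integrable_unimodular[of w]
  by (auto simp: unimodular_def square_integrable_def)

lemma cshift_wshift:
  "unimodular v \<Longrightarrow> unimodular w \<Longrightarrow>
    cshift v a (wshift w b u) = cshift (\<lambda>x. v x * cnj (w (x + a))) (a + b) u"
  by (cases u rule: L2_cases)
    (simp add: wshift_abs_L2 cshift_abs_L2 square_integrable_wshift square_integrable_cshift
      unimodular_mult unimodular_cnj[OF unimodular_translate] mult.assoc add.assoc)

text \<open>Two conjugations cancel on the argument but leave one conjugate on the inner weight, so
  the composite is linear.\<close>

lemma cshift_cshift:
  "unimodular v \<Longrightarrow> unimodular w \<Longrightarrow>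
    cshift v a (cshift w b u) = wshift (\<lambda>x. v x * cnj (w (x + a))) (a + b) u"
  by (cases u rule: L2_cases)
    (simp add: wshift_abs_L2 cshift_abs_L2 square_integrable_wshift square_integrable_cshift
      unimodular_mult unimodular_cnj[OF unimodular_translate] mult.assoc add.assoc)

lemma uminus_wshift: "unimodular w \<Longrightarrow> - wshift w a u = wshift (\<lambda>x. - w x) a u"
  using unimodular_mult[OF unimodular_const[of "-1"], of w]
  by (cases u rule: L2_cases) (simp add: wshift_abs_L2 abs_L2_uminus square_integrable_wshift)

lemma wshift_id: "wshift (\<lambda>_. 1) 0 u = u"
  by (simp add: wshift_def abs_rep_L2)

lemma scaleC_wshift: "unimodular w \<Longrightarrow> cmod z = 1 \<Longrightarrow> z *\<^sub>C wshift w a u = wshift (\<lambda>x. z * w x) a u"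
  using unimodular_mult[OF unimodular_const[of z], of w]
  by (cases u rule: L2_cases) (simp add: wshift_abs_L2 abs_L2_scaleC square_integrable_wshift mult.assoc)

section \<open>Walsh functions\<close>

text \<open>The nontrivial character of the two-element group, from which every Walsh function is a
  product over coordinates.\<close>

definition bsgn :: "bit \<Rightarrow> complex" where
  "bsgn b = (if b = 1 then - 1 else 1)"

lemma bit_add_self: "b + b = (0::bit)"
  by (cases b) simp_all

lemma X_add_self: "x + x = (0::X)"
  by (rule ext) (simp only: plus_fun_apply zero_fun_apply bit_add_self)

lemma bsgn_add: "bsgn (b + c) = bsgn b * bsgn c"
  by (cases b; cases c) (simp_all add: bsgn_def)

lemma bsgn_simps [simp]: "bsgn 0 = 1" "bsgn 1 = - 1" "bsgn b * bsgn b = 1" "cnj (bsgn b) = bsgn b"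
  by (auto simp: bsgn_def)

text \<open>Positions outside the support contribute factors 1. The freedom in \<open>F\<close>
  allows one common index set for several \<alpha>, after which multiplicativity is checked
  coordinate by coordinate.\<close>

lemma walsh_eq_prod:
  assumes "finite F" "{k. \<alpha> k = 1} \<subseteq> F"
  shows "walsh \<alpha> x = (\<Prod>k\<in>F. bsgn (\<alpha> k * x k))"
proof -
  have "{k. \<alpha> k * x k = 1} \<subseteq> F" using assms(2) by auto
  then have "{k. \<alpha> k * x k = 1} = {k \<in> F. \<alpha> k * x k = 1}" by blast
  then show ?thesis
    unfolding walsh_def bsgn_def by (simp only: prod.inter_filter[OF assms(1), symmetric] prod_constant)
qed

lemma walsh_add_left:
  assumes "\<alpha> \<in> \<Delta>" "\<beta> \<in> \<Delta>"
  shows "walsh (\<alpha> + \<beta>) x = walsh \<alpha> x * walsh \<beta> x"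
proof -
  let ?F = "{k. \<alpha> k = 1} \<union> {k. \<beta> k = 1}"
  have F: "finite ?F" using assms by (simp add: \<Delta>_def)
  have "{k. (\<alpha> + \<beta>) k = 1} \<subseteq> ?F"
    by (auto simp: plus_fun_apply)
  then show ?thesis
    by (simp only: walsh_eq_prod[OF F] Un_upper1 Un_upper2 plus_fun_apply distrib_right bsgn_add prod.distrib)
qed

lemma walsh_add_right:
  assumes "\<alpha> \<in> \<Delta>"
  shows "walsh \<alpha> (x + y) = walsh \<alpha> x * walsh \<alpha> y"
proof -
  have F: "finite {k. \<alpha> k = 1}" using assms by (simp add: \<Delta>_def)
  show ?thesis
    by (simp only: walsh_eq_prod[OF F subset_refl] plus_fun_apply distrib_left bsgn_add prod.distrib)
qed

lemma walsh_delta_right: "walsh \<alpha> (\<delta> k) = bsgn (\<alpha> k)"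
proof -
  have "{j. \<alpha> j * \<delta> k j = 1} = (if \<alpha> k = 1 then {k} else {})"
    by (auto simp: \<delta>_def)
  then show ?thesis by (simp add: walsh_def bsgn_def)
qed

lemma walsh_delta_left: "walsh (\<delta> k) x = bsgn (x k)"
proof -
  have "{j. \<delta> k j * x j = 1} = (if x k = 1 then {k} else {})"
    by (auto simp: \<delta>_def)
  then show ?thesis by (simp add: walsh_def bsgn_def)
qed

lemma walsh_zero [simp]: "walsh 0 x = 1" "walsh \<alpha> 0 = 1"
  by (simp_all add: walsh_def)

lemma walsh_ones: "walsh \<alpha> (\<lambda>_. 1) = (- 1) ^ card {k. \<alpha> k = 1}"
  by (simp add: walsh_def)

lemma walsh_square [simp]: "walsh \<alpha> x * walsh \<alpha> x = 1"
  by (simp add: walsh_def flip: power_add)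

lemma cnj_walsh [simp]: "cnj (walsh \<alpha> x) = walsh \<alpha> x"
  by (simp add: walsh_def)

lemma unimodular_walsh: "\<alpha> \<in> \<Delta> \<Longrightarrow> unimodular (walsh \<alpha>)"
  by (simp add: unimodular_def measurable_walsh cmod_walsh)

lemma zero_in_Delta: "0 \<in> \<Delta>"
  by (simp add: \<Delta>_def)

lemma delta_in_Delta: "\<delta> k \<in> \<Delta>"
  by (simp add: \<Delta>_def \<delta>_def)

lemma add_in_Delta: "\<alpha> \<in> \<Delta> \<Longrightarrow> \<beta> \<in> \<Delta> \<Longrightarrow> \<alpha> + \<beta> \<in> \<Delta>"
  unfolding \<Delta>_def mem_Collect_eq
  by (rule finite_subset[of _ "{k. \<alpha> k = 1} \<union> {k. \<beta> k = 1}"]) auto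

lemma sigma_in_Delta: "\<sigma> n \<in> \<Delta>"
  using finite_pos_le by (simp add: \<Delta>_def sigma_apply)

lemma row_in_Delta: "\<gamma> \<in> \<Gamma> \<Longrightarrow> \<gamma> k \<in> \<Delta>"
  by (simp add: \<Gamma>_def \<Delta>_def)

text \<open>An element of \<Delta> is the sum of the \<delta> k over its finite support, so this is
  induction over finite sets.\<close>

lemma Delta_induct [consumes 1, case_names zero add_delta]:
  assumes "\<alpha> \<in> \<Delta>" "P 0" "\<And>\<alpha> k. \<alpha> \<in> \<Delta> \<Longrightarrow> P \<alpha> \<Longrightarrow> P (\<delta> k + \<alpha>)"
  shows "P \<alpha>"
proof -
  have "(\<Sum>k\<in>F. \<delta> k) \<in> \<Delta> \<and> P (\<Sum>k\<in>F. \<delta> k)" if "finite F" for F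
    using that
  proof induction
    case empty
    show ?case unfolding sum.empty using assms(2) zero_in_Delta by blast
  next
    case (insert k F)
    then show ?case
      unfolding sum.insert[OF insert.hyps] using assms(3) add_in_Delta[OF delta_in_Delta] by blast
  qed
  moreover have fin: "finite {k. \<alpha> k = 1}" using assms(1) by (simp add: \<Delta>_def)
  moreover have "(\<Sum>k | \<alpha> k = 1. \<delta> k) = \<alpha>"
  proof (rule ext)
    fix j
    show "(\<Sum>k | \<alpha> k = 1. \<delta> k) j = \<alpha> j"
      by (cases "\<alpha> j")
        (simp_all only: sum_fun_at \<delta>_def sum.delta'[OF fin] mem_Collect_eq simp_thms if_True if_False zero_neq_one)
  qed
  ultimately show ?thesis by metis
qed

section \<open>Density of the Walsh functions\<close>

lemma square_integrable_bounded:
  assumes "f \<in> borel_measurable \<mu>\<^sub>X" "\<And>x. cmod (f x) \<le> B"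
  shows "square_integrable f"
proof -
  interpret prob_space \<mu>\<^sub>X by (rule prob_space_mu_X)
  have "(cmod (f x))\<^sup>2 \<le> B\<^sup>2" for x
    using assms(2)[of x] by (intro power_mono) auto
  then show ?thesis
    using assms(1) unfolding square_integrable_def
    by (auto intro!: integrable_const_bound[where B = "B\<^sup>2"])
qed

lemma square_integrable_indicator:
  "A \<in> sets \<mu>\<^sub>X \<Longrightarrow> square_integrable (indicator A)"
  by (rule square_integrable_bounded[of _ 1]) (auto simp: indicator_def)

text \<open>Dominated convergence applied to the squared differences, with dominating function
  \<open>4 * (cmod (g x))\<^sup>2\<close>.\<close>

lemma tendsto_abs_L2:
  assumes g: "square_integrable g"
    and f: "\<And>n. square_integrable (f n)" "\<And>n x. cmod (f n x) \<le> cmod (g x)"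
    and F: "square_integrable F" "\<And>x. cmod (F x) \<le> cmod (g x)"
    and lim: "\<And>x. (\<lambda>n. f n x) \<longlonglongrightarrow> F x"
  shows "(\<lambda>n. abs_L2 (f n)) \<longlonglongrightarrow> abs_L2 F"
proof -
  have meas: "f n \<in> borel_measurable \<mu>\<^sub>X" "F \<in> borel_measurable \<mu>\<^sub>X" for n
    using f F by (auto simp: square_integrable_def)
  have bound: "(cmod (f n x - F x))\<^sup>2 \<le> 4 * (cmod (g x))\<^sup>2" for n x
  proof -
    have "cmod (f n x - F x) \<le> 2 * cmod (g x)"
      using norm_triangle_ineq4[of "f n x" "F x"] f(2)[of n x] F(2)[of x] by linarith
    from power_mono[OF this, of 2] show ?thesis by (simp add: power_mult_distrib)
  qed
  have diff: "square_integrable (\<lambda>x. f n x - F x)" for n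
    using square_integrable_add[OF f(1) square_integrable_cmult[OF F(1), of "-1"], of n] by simp
  have "(\<lambda>n. \<integral>x. (cmod (f n x - F x))\<^sup>2 \<partial>\<mu>\<^sub>X) \<longlonglongrightarrow> (\<integral>x. 0 \<partial>\<mu>\<^sub>X)"
  proof (rule integral_dominated_convergence[where w = "\<lambda>x. 4 * (cmod (g x))\<^sup>2"])
    show "AE x in \<mu>\<^sub>X. (\<lambda>n. (cmod (f n x - F x))\<^sup>2) \<longlonglongrightarrow> 0"
    proof (rule AE_I2)
      fix x
      have "(\<lambda>n. (cmod (f n x - F x))\<^sup>2) \<longlonglongrightarrow> (cmod (F x - F x))\<^sup>2"
        by (intro tendsto_intros lim)
      then show "(\<lambda>n. (cmod (f n x - F x))\<^sup>2) \<longlonglongrightarrow> 0" by simp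
    qed
  qed (use g meas bound in \<open>auto simp: square_integrable_def\<close>)
  then have "(\<lambda>n. sqrt (\<integral>x. (cmod (f n x - F x))\<^sup>2 \<partial>\<mu>\<^sub>X)) \<longlonglongrightarrow> sqrt 0"
    by (intro tendsto_intros) simp
  then have "(\<lambda>n. norm (abs_L2 (f n) - abs_L2 F)) \<longlonglongrightarrow> 0"
    by (simp add: abs_L2_diff f F norm_abs_L2 diff)
  then show ?thesis
    by (simp add: LIM_zero_iff tendsto_norm_zero_iff)
qed

text \<open>Density of the span of the Walsh functions, phrased so that it serves as an induction
  principle for closed conditions. The proof climbs from cylinder sets to measurable sets, simple
  functions and finally all square integrable functions.\<close>

theorem closed_csubspace_Walsh:
  assumes D: "csubspace D" "closed D" and walsh: "\<And>\<alpha>. \<alpha> \<in> \<Delta> \<Longrightarrow> abs_L2 (walsh \<alpha>) \<in> D"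
  shows "D = UNIV"
proof -
  define P where "P f \<longleftrightarrow> square_integrable f \<and> abs_L2 f \<in> D" for f
  have P_walsh: "P (walsh \<alpha>)" if "\<alpha> \<in> \<Delta>" for \<alpha>
    using that walsh by (simp add: P_def square_integrable_unimodular unimodular_walsh)
  have P_add: "P (\<lambda>x. f x + g x)" if "P f" "P g" for f g
    using that D(1) by (auto simp: P_def csubspace_def square_integrable_add simp flip: abs_L2_add)
  have P_cmult: "P (\<lambda>x. a * f x)" if "P f" for a f
    using that D(1) by (auto simp: P_def csubspace_def square_integrable_cmult simp flip: abs_L2_scaleC)
  have P_zero: "P (\<lambda>_. 0)"
    using P_cmult[OF P_walsh[OF zero_in_Delta], of 0] by simp
  have P_one: "P (\<lambda>_. 1)"
  proof -
    have "walsh 0 = (\<lambda>_. 1)" by (rule ext) (rule walsh_zero)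
    then show ?thesis using P_walsh[OF zero_in_Delta] by (simp only:)
  qed
  have P_lim: "P F"
    if "square_integrable g" "\<And>n. P (f n)" "\<And>n x. cmod (f n x) \<le> cmod (g x)"
      "square_integrable F" "\<And>x. cmod (F x) \<le> cmod (g x)" "\<And>x. (\<lambda>n. f n x) \<longlonglongrightarrow> F x" for f F g
    using closed_sequentially[OF D(2) _ tendsto_abs_L2[OF that(1) _ that(3-6)]] that(2,4)
    by (simp add: P_def)
  \<comment> \<open>The Walsh factor must stay arbitrary: each new coordinate \<open>j\<close>
    changes \<alpha> into \<open>\<delta> j + \<alpha>\<close> in one of the two resulting
    terms.\<close>
  have P_cylinder: "P (\<lambda>x. walsh \<alpha> x * (\<Prod>j\<in>J. indicator (E j) (x j)))"
    if "finite J" "\<alpha> \<in> \<Delta>" for \<alpha> J E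
    using that
  proof (induction J arbitrary: \<alpha>)
    case empty
    then show ?case using P_walsh by simp
  next
    case (insert j J)
    let ?p = "\<lambda>x. \<Prod>j\<in>J. indicator (E j) (x j) :: complex"
    \<comment> \<open>The Fourier coefficients of the indicator of \<open>E j\<close> as a function
      on the two-element group.\<close>
    define c d :: complex where "c = (indicator (E j) 0 + indicator (E j) 1) / 2"
      and "d = (indicator (E j) 0 - indicator (E j) 1) / 2"
    have cd: "indicator (E j) b = c + d * bsgn b" for b
      by (cases b) (simp_all add: c_def d_def field_simps)
    have "walsh \<alpha> x * (\<Prod>j\<in>insert j J. indicator (E j) (x j)) =
        c * (walsh \<alpha> x * ?p x) + d * (walsh (\<delta> j + \<alpha>) x * ?p x)" for x
      unfolding prod.insert[OF insert.hyps] cd walsh_add_left[OF delta_in_Delta insert.prems]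
        walsh_delta_left by algebra
    moreover have "P (\<lambda>x. c * (walsh \<alpha> x * ?p x) + d * (walsh (\<delta> j + \<alpha>) x * ?p x))"
      by (intro P_add P_cmult insert.IH add_in_Delta delta_in_Delta insert.prems)
    ultimately show ?case by (simp only:)
  qed
  have P_indicator: "P (indicator A)" if "A \<in> sets \<mu>\<^sub>X" for A
  proof -
    let ?U = "\<lambda>_::pos. uniform_count_measure (UNIV :: bit set)"
    let ?\<Omega> = "Pi\<^sub>E UNIV (\<lambda>i. space (?U i))" and ?G = "prod_algebra UNIV ?U"
    have \<Omega>: "?\<Omega> = UNIV" by (auto simp: space_uniform_count_measure)
    have sets: "sets \<mu>\<^sub>X = sigma_sets ?\<Omega> ?G" by (simp only: \<mu>\<^sub>X_def sets_PiM)
    \<comment> \<open>Cylinder sets are an intersection-stable generator, so by the \<pi>-\<lambda>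
      argument only complements and disjoint countable unions remain.\<close>
    show ?thesis
      using Int_stable_prod_algebra prod_algebra_sets_into_space that[unfolded sets]
    proof (induction rule: sigma_sets_induct_disjoint)
      case (basic A)
      then obtain J E where A: "A = prod_emb UNIV ?U J (Pi\<^sub>E J E)" and J: "finite J"
        by (rule prod_algebraE)
      have "indicator A x = walsh 0 x * (\<Prod>j\<in>J. indicator (E j) (x j))" for x
        using J unfolding A
        by (auto simp: prod_emb_def space_PiM space_uniform_count_measure indicator_def Pi_iff)
      then have "indicator A = (\<lambda>x. walsh 0 x * (\<Prod>j\<in>J. indicator (E j) (x j)))" by blast
      then show ?case using P_cylinder[OF J zero_in_Delta, of E] by (simp only:)
    next
      case empty
      then show ?case using P_zero by simp
    next
      case (compl A)
      have "indicator (?\<Omega> - A) = (\<lambda>x. 1 + - 1 * indicator A x :: complex)"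
        by (rule ext) (simp add: \<Omega> indicator_def)
      then show ?case
        using P_add[OF P_one P_cmult[OF compl.IH]] by (simp only:)
    next
      case (union A)
      have A: "A i \<in> sets \<mu>\<^sub>X" for i using union.hyps sets by blast
      \<comment> \<open>By disjointness the indicator of a finite union is a sum of indicators; the
        countable union is then a limit dominated by the constant 1.\<close>
      have partial: "P (indicator (\<Union>i<n. A i))" for n
      proof (induction n)
        case 0
        then show ?case using P_zero by simp
      next
        case (Suc n)
        have "A n \<inter> A i = {}" if "i < n" for i
          using disjoint_family_onD[OF union.hyps(1), of n i] that by simp
        then have "A n \<inter> (\<Union>i<n. A i) = {}" by auto
        then have "indicator (A n \<union> (\<Union>i<n. A i)) =
            (\<lambda>x. indicator (A n) x + indicator (\<Union>i<n. A i) x :: complex)"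
          by (intro ext indicator_add[symmetric])
        then show ?case
          using P_add[OF union.IH Suc] by (simp only: lessThan_Suc UN_insert)
      qed
      show ?case
      proof (rule P_lim[where g = "\<lambda>_. 1" and f = "\<lambda>n. indicator (\<Union>i<n. A i)", OF _ partial])
        show "square_integrable (\<lambda>_. 1)" using P_one by (simp only: P_def)
        show "square_integrable (indicator (\<Union>i. A i))"
          using A by (intro square_integrable_indicator sets.countable_UN) auto
        show "cmod (indicator B x) \<le> cmod 1" for B and x :: X
          by (simp add: indicator_def)
        then show "cmod (indicator B x) \<le> cmod 1" for B and x :: X .
        show "(\<lambda>n. indicator (\<Union>i<n. A i) x :: complex) \<longlonglongrightarrow> indicator (\<Union>i. A i) x" for x
          by (rule LIMSEQ_indicator_UN)
      qed
    qed
  qed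
  have P_simple: "P f" if "simple_function \<mu>\<^sub>X f" for f
  proof -
    \<comment> \<open>An arbitrary finite \<open>Y\<close> in place of the range of \<open>f\<close>
      makes the induction possible.\<close>
    have "P (\<lambda>x. \<Sum>y\<in>Y. y * indicator (f -` {y}) x)" if "finite Y" for Y
      using that
    proof induction
      case empty
      then show ?case using P_zero by simp
    next
      case (insert y Y)
      have "f -` {y} \<in> sets \<mu>\<^sub>X"
        using simple_functionD(2)[OF \<open>simple_function \<mu>\<^sub>X f\<close>, of "{y}"] by simp
      then show ?case
        unfolding sum.insert[OF insert.hyps]
        by (intro P_add P_cmult P_indicator insert.IH)
    qed
    moreover have fin: "finite (range f)"
      using simple_functionD(1)[OF that] by simp
    moreover have "(\<Sum>y\<in>range f. y * indicator (f -` {y}) x) = f x" for x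
    proof -
      have "y * indicator (f -` {y}) x = (if f x = y then y else 0)" for y
        by (simp add: indicator_def)
      then show ?thesis by (simp only: sum.delta'[OF fin] rangeI if_True)
    qed
    ultimately have "P (\<lambda>x. f x)" by (metis (no_types, lifting) ext)
    then show ?thesis .
  qed
  have "P f" if f: "square_integrable f" for f
  proof -
    have "f \<in> borel_measurable \<mu>\<^sub>X" using f by (simp add: square_integrable_def)
    \<comment> \<open>With base point 0 the approximating simple functions are bounded by twice
      \<open>f\<close>, which supplies the square integrable dominating function.\<close>
    from borel_measurable_implies_sequence_metric[OF this, of 0]
    obtain F where F: "\<And>i. simple_function \<mu>\<^sub>X (F i)" "\<And>x. (\<lambda>i. F i x) \<longlonglongrightarrow> f x"
        "\<And>i x. cmod (F i x) \<le> cmod (2 * f x)"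
      by (auto simp: norm_mult)
    show ?thesis
      by (rule P_lim[OF square_integrable_cmult[OF f, of 2] P_simple[OF F(1)] F(3) f _ F(2)])
        (simp add: norm_mult)
  qed
  then show ?thesis
    by (metis L2_cases P_def UNIV_eq_I)
qed

section \<open>The spinor relations and the invariant structures\<close>

lemma J_op_eq: "J_op \<gamma> k = wshift (\<lambda>x. - \<i> * walsh (\<sigma> (nat_of_pos k - 1) + \<gamma> k) x) (\<delta> k)"
  unfolding J_op_def wshift_def ..

text \<open>The factor 1 gives both families the form \<open>z * walsh \<alpha> x\<close>, with
  \<open>z = - \<i>\<close> and \<open>z = 1\<close>, so that the same lemmas apply to both.\<close>

lemma J'_op_eq: "J'_op \<gamma> k = wshift (\<lambda>x. 1 * walsh (\<sigma> (nat_of_pos k) + \<gamma> k) x) (\<delta> k)"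
  unfolding J'_op_def wshift_def mult_1 ..

text \<open>The trivial weight is written as \<open>walsh 0\<close> so that \<open>S_op\<close> and
  \<open>Q_op\<close> are the cases \<epsilon> = 0 and \<epsilon> = \<open>\<delta> 1\<close> of a
  single antilinear operator.\<close>

lemma S_op_eq: "S_op = cshift (walsh 0) (\<lambda>_. 1)"
  unfolding S_op_def cshift_def check_def walsh_zero mult_1 ..

lemma Q_op_eq: "Q_op = cshift (walsh (\<delta> 1)) (\<lambda>_. 1)"
  unfolding Q_op_def cshift_def check_def walsh_delta_left bsgn_def ..

lemma unimodular_walsh_mult: "cmod z = 1 \<Longrightarrow> \<alpha> \<in> \<Delta> \<Longrightarrow> unimodular (\<lambda>x. z * walsh \<alpha> x)"
  by (intro unimodular_mult unimodular_const unimodular_walsh)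

lemma wshift_walsh_wshift_walsh:
  assumes "cmod y = 1" "cmod z = 1" "\<alpha> \<in> \<Delta>" "\<beta> \<in> \<Delta>"
  shows "wshift (\<lambda>x. y * walsh \<alpha> x) (\<delta> k) (wshift (\<lambda>x. z * walsh \<beta> x) (\<delta> l) u) =
    wshift (\<lambda>x. y * z * bsgn (\<beta> k) * (walsh \<alpha> x * walsh \<beta> x)) (\<delta> k + \<delta> l) u"
  using assms
  by (simp only: wshift_wshift unimodular_walsh_mult walsh_add_right walsh_delta_right ac_simps)

text \<open>The two products have the same translation and the same Walsh weight; they differ only
  in the sign that the inner weight acquires under the outer translation.\<close>

lemma anticommute_wshift_walsh:
  assumes "cmod y = 1" "cmod z = 1" "\<alpha> \<in> \<Delta>" "\<beta> \<in> \<Delta>" "bsgn (\<beta> k) = - bsgn (\<alpha> l)"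
  shows "anticommute (wshift (\<lambda>x. y * walsh \<alpha> x) (\<delta> k)) (wshift (\<lambda>x. z * walsh \<beta> x) (\<delta> l))"
proof -
  have *: "unimodular (\<lambda>x. z * y * bsgn (\<alpha> l) * (walsh \<beta> x * walsh \<alpha> x))"
    using assms by (intro unimodular_mult unimodular_const unimodular_walsh) (auto simp: norm_mult bsgn_def)
  show ?thesis
    unfolding anticommute_def wshift_walsh_wshift_walsh[OF assms(1-4)]
      wshift_walsh_wshift_walsh[OF assms(2,1,4,3)] uminus_wshift[OF *] assms(5)
    by (simp add: mult_ac add.commute[of "\<delta> k"])
qed

lemma wshift_walsh_square:
  assumes "cmod z = 1" "\<alpha> \<in> \<Delta>" "z * z * bsgn (\<alpha> k) = - 1"
  shows "wshift (\<lambda>x. z * walsh \<alpha> x) (\<delta> k) (wshift (\<lambda>x. z * walsh \<alpha> x) (\<delta> k) u) = - u"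
  \<comment> \<open>The vector \<open>- u\<close> is itself a shift of \<open>u\<close>, with
    constant weight -1 and zero translation.\<close>
  using uminus_wshift[OF unimodular_const[of 1], of 0 u]
  unfolding wshift_walsh_wshift_walsh[OF assms(1,1,2,2)] assms(3) walsh_square X_add_self
  by (simp add: wshift_id)

lemma nat_of_pos_ge_1: "1 \<le> nat_of_pos k"
  using nat_of_pos[of k] by simp

lemma bsgn_sigma_add_row:
  "bsgn ((\<sigma> n + \<gamma> k) l) = (if nat_of_pos l \<le> n then - bsgn (\<gamma> k l) else bsgn (\<gamma> k l))"
  by (simp only: plus_fun_apply bsgn_add sigma_apply) (auto simp: bsgn_def)

lemma spinor_rep_J_op:
  assumes \<gamma>: "\<gamma> \<in> \<Gamma>"
  shows "spinor_rep (J_op \<gamma>) (J'_op \<gamma>)"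
proof -
  note D = sigma_add_row_in_Delta[OF \<gamma>]
  have z: "cmod (- \<i>) = 1" "cmod 1 = 1" by simp_all
  have sym: "\<gamma> k l = \<gamma> l k" and diag: "\<gamma> k k = 0" for k l
    using \<gamma> by (auto simp: \<Gamma>_def)
  \<comment> \<open>The row \<gamma> k vanishes at k. The minus sign comes from the square of
    \<open>- \<i>\<close> for \<open>J_op\<close>, and from the k-th entry of \<sigma> for
    \<open>J'_op\<close>.\<close>
  have sq: "J_op \<gamma> k (J_op \<gamma> k u) = - u" "J'_op \<gamma> k (J'_op \<gamma> k u) = - u" for k u
    unfolding J_op_eq J'_op_eq using nat_of_pos_ge_1[of k]
    by (intro wshift_walsh_square z D; simp add: bsgn_sigma_add_row diag del: plus_fun_apply)+
  \<comment> \<open>By symmetry of \<gamma> the two signs would agree without \<sigma>. It flips the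
    first when k precedes l and the second when l precedes k, hence exactly one of them.\<close>
  have ac: "anticommute (J_op \<gamma> k) (J_op \<gamma> l)" "anticommute (J'_op \<gamma> k) (J'_op \<gamma> l)"
    if "k \<noteq> l" for k l
    unfolding J_op_eq J'_op_eq using that nat_of_pos_ge_1[of k] nat_of_pos_ge_1[of l]
    by (intro anticommute_wshift_walsh z D;
        auto simp: bsgn_sigma_add_row sym[of k l] nat_of_pos_inject[symmetric] simp del: plus_fun_apply)+
  \<comment> \<open>Here the flips occur for k at most l and for l strictly below k. Exactly one of
    these holds even when k = l, thanks to the index \<open>nat_of_pos k - 1\<close> in
    \<open>J_op\<close>.\<close>
  have ac': "anticommute (J_op \<gamma> k) (J'_op \<gamma> l)" for k l
    unfolding J_op_eq J'_op_eq using nat_of_pos_ge_1[of k]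
    by (intro anticommute_wshift_walsh z D)
      (auto simp: bsgn_sigma_add_row sym[of k l] simp del: plus_fun_apply)
  have lin: "clinear (J_op \<gamma> k)" "norm_preserving (J_op \<gamma> k)"
    "clinear (J'_op \<gamma> k)" "norm_preserving (J'_op \<gamma> k)" for k
    unfolding J_op_eq J'_op_eq norm_preserving_def
    by (simp_all only: clinear_wshift norm_wshift unimodular_walsh_mult z D simp_thms)
  show ?thesis
    unfolding spinor_rep_def by (intro conjI allI impI; (rule lin sq ac' | erule ac))
qed

section \<open>Parity conditions and the antilinear structures\<close>

lemma walsh_sigma_ones: "walsh (\<sigma> n) (\<lambda>_. 1) = (- 1) ^ n"
proof -
  \<comment> \<open>Since positions start at 1, exactly n of them are at most n.\<close>
  have "m \<in> nat_of_pos ` {k. nat_of_pos k \<le> n}" if "1 \<le> m" "m \<le> n" for m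
    using that pos_of_nat_inverse[of m] by (intro image_eqI[of _ _ "pos_of_nat m"]) auto
  then have "nat_of_pos ` {k. nat_of_pos k \<le> n} = {1..n}"
    using nat_of_pos_ge_1 by auto
  then have "card {k. nat_of_pos k \<le> n} = n"
    using card_image[of nat_of_pos "{k. nat_of_pos k \<le> n}"] by (simp add: inj_on_def nat_of_pos_inject)
  moreover have "{k. \<sigma> n k = 1} = {k. nat_of_pos k \<le> n}"
    by (simp add: sigma_apply)
  ultimately show ?thesis by (simp add: walsh_ones)
qed

text \<open>The last hypothesis equates the scalars from the two orders: conjugating z and moving
  \<alpha> by the all-ones point on one side, moving \<epsilon> by \<delta> k on the other.\<close>

lemma commute_cshift_wshift_walsh:
  assumes "cmod z = 1" "\<alpha> \<in> \<Delta>" "\<epsilon> \<in> \<Delta>" "cnj z * walsh \<alpha> (\<lambda>_. 1) = z * bsgn (\<epsilon> k)"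
  shows "cshift (walsh \<epsilon>) (\<lambda>_. 1) (wshift (\<lambda>x. z * walsh \<alpha> x) (\<delta> k) u) =
    wshift (\<lambda>x. z * walsh \<alpha> x) (\<delta> k) (cshift (walsh \<epsilon>) (\<lambda>_. 1) u)"
proof -
  have "walsh \<epsilon> x * cnj (z * (walsh \<alpha> x * walsh \<alpha> (\<lambda>_. 1))) =
      z * walsh \<alpha> x * (walsh \<epsilon> x * bsgn (\<epsilon> k))" for x
    using assms(4) unfolding complex_cnj_mult cnj_walsh by algebra
  then show ?thesis
    using assms(1-3)
    by (simp only: cshift_wshift wshift_cshift unimodular_walsh unimodular_walsh_mult
        walsh_add_right walsh_delta_right add.commute[of "\<delta> k"])
qed

lemma commutes_with_rep_cshift_walsh:
  assumes \<gamma>: "\<gamma> \<in> \<Gamma>" and \<epsilon>: "\<epsilon> \<in> \<Delta>"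
    and parity: "\<And>k. walsh (\<gamma> k) (\<lambda>_. 1) = (- 1) ^ nat_of_pos k * bsgn (\<epsilon> k)"
  shows "commutes_with_rep (J_op \<gamma>) (J'_op \<gamma>) (cshift (walsh \<epsilon>) (\<lambda>_. 1))"
proof -
  have w: "walsh (\<sigma> n + \<gamma> k) (\<lambda>_. 1) = (- 1) ^ n * ((- 1) ^ nat_of_pos k * bsgn (\<epsilon> k))" for n k
    by (simp only: walsh_add_left[OF sigma_in_Delta row_in_Delta[OF \<gamma>]] walsh_sigma_ones parity)
  \<comment> \<open>For \<open>J'_op\<close> the two powers of -1 cancel. For \<open>J_op\<close>
    the exponents differ by one, and the resulting minus sign matches
    \<open>cnj (- \<i>) = - (- \<i>)\<close>.\<close>
  have p: "(- 1) ^ nat_of_pos k * ((- 1) ^ nat_of_pos k * b) = b"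
    "(- 1) ^ (nat_of_pos k - 1) * ((- 1) ^ nat_of_pos k * b) = - b" for k and b :: complex
    using nat_of_pos_ge_1[of k]
    by (simp_all add: power_add[symmetric] mult.assoc[symmetric] uminus_power_if)
  show ?thesis
    unfolding commutes_with_rep_def J_op_eq J'_op_eq
    by (intro allI conjI commute_cshift_wshift_walsh \<epsilon> sigma_add_row_in_Delta \<gamma>)
      (simp_all only: w p, simp_all)
qed

text \<open>The square is the scalar \<open>walsh \<epsilon> (\<lambda>_. 1)\<close>: it is 1 for
  \<epsilon> = 0 and -1 for \<epsilon> = \<open>\<delta> 1\<close>, which separates the real from
  the quaternionic case.\<close>

lemma cshift_walsh_square:
  assumes "\<epsilon> \<in> \<Delta>"
  shows "cshift (walsh \<epsilon>) (\<lambda>_. 1) (cshift (walsh \<epsilon>) (\<lambda>_. 1) u) =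
    wshift (\<lambda>_. walsh \<epsilon> (\<lambda>_. 1)) 0 u"
proof -
  have "walsh \<epsilon> x * cnj (walsh \<epsilon> x * walsh \<epsilon> (\<lambda>_. 1)) = walsh \<epsilon> (\<lambda>_. 1)" for x
    by (simp add: mult.assoc[symmetric])
  then show ?thesis
    using assms by (simp only: cshift_cshift unimodular_walsh walsh_add_right X_add_self)
qed

lemma walsh_ones_cong:
  "[card {j. \<alpha> j = 1} = n] (mod 2) \<Longrightarrow> walsh \<alpha> (\<lambda>_. 1) = (- 1) ^ n"
  unfolding walsh_ones by (auto simp: cong_def uminus_power_if even_iff_mod_2_eq_zero)

lemma real_structure_S_op:
  assumes "\<gamma> \<in> \<Gamma>\<^sub>1"
  shows "real_structure (J_op \<gamma>) (J'_op \<gamma>) S_op"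
  unfolding real_structure_def S_op_eq norm_preserving_def
proof (intro conjI allI)
  have "walsh (\<gamma> k) (\<lambda>_. 1) = (- 1) ^ nat_of_pos k * bsgn (0 k)" for k
    using assms walsh_ones_cong[of "\<gamma> k" "nat_of_pos k"] by (simp add: \<Gamma>\<^sub>1_def)
  then show "commutes_with_rep (J_op \<gamma>) (J'_op \<gamma>) (cshift (walsh 0) (\<lambda>_. 1))"
    using assms by (intro commutes_with_rep_cshift_walsh zero_in_Delta) (auto simp: \<Gamma>\<^sub>1_def)
  show "cshift (walsh 0) (\<lambda>_. 1) (cshift (walsh 0) (\<lambda>_. 1) u) = u" for u
    by (simp only: cshift_walsh_square[OF zero_in_Delta] walsh_zero wshift_id)
qed (simp_all only: antilinear_cshift norm_cshift unimodular_walsh zero_in_Delta)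

lemma quaternionic_structure_Q_op:
  assumes "\<gamma> \<in> \<Gamma>\<^sub>m\<^sub>1"
  shows "quaternionic_structure (J_op \<gamma>) (J'_op \<gamma>) Q_op"
  unfolding quaternionic_structure_def Q_op_eq norm_preserving_def
proof (intro conjI allI)
  have one: "nat_of_pos 1 = 1"
    by (simp add: one_pos_def pos_of_nat_inverse)
  have "walsh (\<gamma> k) (\<lambda>_. 1) = (- 1) ^ nat_of_pos k * bsgn (\<delta> 1 k)" for k
  \<comment> \<open>Row 1 has even weight although its index is odd; the sign of
    \<open>\<delta> 1\<close> at position 1 compensates exactly this discrepancy.\<close>
  proof (cases "k = 1")
    case True
    then show ?thesis
      using assms walsh_ones_cong[of "\<gamma> 1" 0] by (simp add: \<Gamma>\<^sub>m\<^sub>1_def one \<delta>_def)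
  next
    case False
    then have "nat_of_pos k \<ge> 2"
      using nat_of_pos_ge_1[of k] one nat_of_pos_inject[of k 1] by linarith
    then show ?thesis
      using assms False walsh_ones_cong[of "\<gamma> k" "nat_of_pos k"] by (simp add: \<Gamma>\<^sub>m\<^sub>1_def \<delta>_def)
  qed
  then show "commutes_with_rep (J_op \<gamma>) (J'_op \<gamma>) (cshift (walsh (\<delta> 1)) (\<lambda>_. 1))"
    using assms by (intro commutes_with_rep_cshift_walsh delta_in_Delta) (auto simp: \<Gamma>\<^sub>m\<^sub>1_def)
  show "cshift (walsh (\<delta> 1)) (\<lambda>_. 1) (cshift (walsh (\<delta> 1)) (\<lambda>_. 1) u) = - u" for u
    using uminus_wshift[OF unimodular_const[of 1], of 0 u]
    by (simp add: cshift_walsh_square[OF delta_in_Delta] walsh_delta_left wshift_id)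
qed (simp_all only: antilinear_cshift norm_cshift unimodular_walsh delta_in_Delta)

lemma invariant_real_form_S_op: "invariant_real_form S_op = L2_real"
proof -
  have "S_op u = u \<longleftrightarrow> u \<in> L2_real" for u
  proof (cases u rule: L2_cases)
    case (1 f)
    have c: "square_integrable (\<lambda>x. cnj (f (check x)))"
      unfolding check_def by (intro square_integrable_cnj square_integrable_translate 1)
    have "S_op u = u \<longleftrightarrow> (AE x in \<mu>\<^sub>X. cnj (f (check x)) = f x)"
      using 1 c by (simp add: S_op_abs_L2 abs_L2_eq_iff)
    \<comment> \<open>Both sides are conjugated at the same point x.\<close>
    also have "\<dots> \<longleftrightarrow> (AE x in \<mu>\<^sub>X. cnj (f x) = f (check x))"
      by (intro arg_cong[where f = "\<lambda>P. AE x in \<mu>\<^sub>X. P x"] ext) (metis complex_cnj_cnj)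
    also have "\<dots> \<longleftrightarrow> u \<in> L2_real"
      using 1 by (simp add: L2_real_abs_L2)
    finally show ?thesis .
  qed
  then show ?thesis by (auto simp: invariant_real_form_def)
qed

section \<open>Irreducibility\<close>

lemma csubspace_add: "csubspace W \<Longrightarrow> u \<in> W \<Longrightarrow> v \<in> W \<Longrightarrow> u + v \<in> W"
  by (simp add: csubspace_def)

lemma csubspace_scaleC: "csubspace W \<Longrightarrow> u \<in> W \<Longrightarrow> a *\<^sub>C u \<in> W"
  by (simp add: csubspace_def)

lemma csubspace_scaleR: "csubspace W \<Longrightarrow> u \<in> W \<Longrightarrow> r *\<^sub>R u \<in> W"
  by (simp add: scaleR_scaleC csubspace_scaleC)

lemma clinear_add: "clinear T \<Longrightarrow> T (u + v) = T u + T v"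
  by (simp add: clinear_def)

lemma clinear_scaleC: "clinear T \<Longrightarrow> T (a *\<^sub>C u) = a *\<^sub>C T u"
  by (simp add: clinear_def)

lemma clinear_diff: "clinear T \<Longrightarrow> T (u - v) = T u - T v"
  by (metis add_diff_cancel clinear_add diff_add_cancel)

text \<open>Polarization: the real inner product is determined by the norm.\<close>

lemma inner_norm_preserving:
  assumes "clinear T" "norm_preserving T"
  shows "inner (T u) (T v) = inner u (v :: L2)"
  using assms by (simp add: dot_norm norm_preserving_def flip: clinear_add)

lemma inner_wshift: "unimodular w \<Longrightarrow> inner (wshift w a u) (wshift w a v) = inner u v"
  by (intro inner_norm_preserving clinear_wshift) (simp_all add: norm_preserving_def norm_wshift)

text \<open>The available inner product is only real bilinear, so complex scalars are split into a
  real multiple of u and one of \<open>\<i> *\<^sub>C u\<close>.\<close>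

lemma scaleC_Complex:
  fixes u :: "'v::complex_normed_vector"
  shows "a *\<^sub>C u = Re a *\<^sub>R u + Im a *\<^sub>R (\<i> *\<^sub>C u)"
proof -
  have "a *\<^sub>C u = (complex_of_real (Re a) + complex_of_real (Im a) * \<i>) *\<^sub>C u"
    by (subst complex_eq) (simp only: mult.commute)
  then show ?thesis by (simp only: scaleC_add_left scaleR_scaleC scaleC_scaleC)
qed

lemma ii_ii_scaleC:
  fixes u :: "'v::complex_normed_vector"
  shows "\<i> *\<^sub>C \<i> *\<^sub>C u = - u"
proof -
  have "(- 1) *\<^sub>C u = - u"
    using scaleR_scaleC[of "- 1" u] by simp
  then show ?thesis by (simp add: scaleC_scaleC)
qed

lemma inner_ii_ii: "inner (\<i> *\<^sub>C u) (\<i> *\<^sub>C v) = inner u (v :: L2)"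
  by (intro inner_norm_preserving)
    (simp_all add: clinear_def norm_preserving_def norm_scaleC scaleC_add_right scaleC_scaleC mult.commute)

text \<open>Multiplication by \<open>\<i>\<close> is an isometry with square -1, hence
  skew-adjoint.\<close>

lemma inner_ii_left: "inner (\<i> *\<^sub>C u) v = - inner u (\<i> *\<^sub>C v :: L2)"
  using inner_ii_ii[of u "\<i> *\<^sub>C v"] by (simp add: ii_ii_scaleC)

section \<open>Walsh vectors, the mean, and averages over coordinates\<close>

definition wbasis :: "X \<Rightarrow> L2" where
  "wbasis \<alpha> = abs_L2 (walsh \<alpha>)"

lemma wshift_wbasis_translate:
  "\<alpha> \<in> \<Delta> \<Longrightarrow> wshift (\<lambda>_. 1) (\<delta> k) (wbasis \<alpha>) = bsgn (\<alpha> k) *\<^sub>C wbasis \<alpha>"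
  by (simp only: wbasis_def wshift_abs_L2 unimodular_const[OF norm_one] square_integrable_unimodular
      unimodular_walsh abs_L2_scaleC walsh_add_right walsh_delta_right mult_1 mult.commute)

lemma wshift_wbasis_mult:
  "\<alpha> \<in> \<Delta> \<Longrightarrow> \<beta> \<in> \<Delta> \<Longrightarrow> wshift (walsh \<alpha>) 0 (wbasis \<beta>) = wbasis (\<alpha> + \<beta>)"
  unfolding wbasis_def
  by (subst ext[of "walsh (\<alpha> + \<beta>)", OF walsh_add_left])
    (simp_all only: wshift_abs_L2 square_integrable_unimodular unimodular_walsh add_0_right)

text \<open>This is the integral of u over X, since \<open>wbasis 0\<close> is the constant function
  1 and the two real inner products integrate the real and imaginary parts.\<close>

definition mean :: "L2 \<Rightarrow> complex" where
  "mean u = Complex (inner (wbasis 0) u) (inner (\<i> *\<^sub>C wbasis 0) u)"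

lemma mean_add: "mean (u + v) = mean u + mean v"
  by (simp add: mean_def inner_add_right complex_eq_iff)

lemma mean_scaleC: "mean (a *\<^sub>C u) = a * mean u"
  unfolding scaleC_Complex[of a u]
  by (simp add: mean_def inner_add_right inner_ii_ii complex_eq_iff inner_ii_left ii_ii_scaleC)

lemma norm_wbasis: "\<alpha> \<in> \<Delta> \<Longrightarrow> norm (wbasis \<alpha>) = 1"
  using prob_space.prob_space[OF prob_space_mu_X]
  by (simp add: wbasis_def norm_abs_L2 square_integrable_unimodular unimodular_walsh cmod_walsh)

lemma cmod_mean: "cmod (mean u) \<le> 2 * norm u"
proof -
  have "\<bar>inner (wbasis 0) u\<bar> \<le> norm u" "\<bar>inner (\<i> *\<^sub>C wbasis 0) u\<bar> \<le> norm u"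
    using Cauchy_Schwarz_ineq2[of "wbasis 0" u] Cauchy_Schwarz_ineq2[of "\<i> *\<^sub>C wbasis 0" u]
    by (simp_all only: norm_scaleC norm_wbasis[OF zero_in_Delta] norm_ii mult_1)
  then show ?thesis
    using cmod_le[of "mean u"] by (simp add: mean_def)
qed

lemma mean_wbasis_0: "mean (wbasis 0) = 1"
proof -
  have "inner (wbasis 0) (wbasis 0) = 1"
    using norm_wbasis[OF zero_in_Delta] by (simp only: norm_eq_1)
  moreover have "inner (\<i> *\<^sub>C wbasis 0) (wbasis 0) = 0"
    using inner_ii_left[of "wbasis 0" "wbasis 0"] inner_commute[of "wbasis 0" "\<i> *\<^sub>C wbasis 0"] by linarith
  ultimately show ?thesis by (simp only: mean_def one_complex.code)
qed

text \<open>Translation is an isometry fixing \<open>wbasis 0\<close> and its multiple by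
  \<open>\<i>\<close>, so both inner products are preserved.\<close>

lemma mean_wshift_translate: "mean (wshift (\<lambda>_. 1) (\<delta> k) u) = mean u"
proof -
  let ?T = "wshift (\<lambda>_. 1) (\<delta> k)"
  have T: "unimodular (\<lambda>_. 1)" by (rule unimodular_const) simp
  have e: "?T (wbasis 0) = wbasis 0"
    using wshift_wbasis_translate[OF zero_in_Delta, of k] by (simp add: scaleC_one)
  have "inner (wbasis 0) (?T u) = inner (wbasis 0) u"
    using inner_wshift[OF T, of "\<delta> k" "wbasis 0" u] by (simp only: e)
  moreover have "inner (\<i> *\<^sub>C wbasis 0) (?T u) = inner (\<i> *\<^sub>C wbasis 0) u"
    using inner_wshift[OF T, of "\<delta> k" "\<i> *\<^sub>C wbasis 0" u]
    by (simp only: clinear_scaleC[OF clinear_wshift[OF T]] e)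
  ultimately show ?thesis by (simp only: mean_def)
qed

text \<open>Translation by \<delta> k preserves the mean but negates this Walsh vector, so its mean
  equals its own negative.\<close>

lemma mean_wbasis:
  assumes "\<alpha> \<in> \<Delta>" "\<alpha> k = 1"
  shows "mean (wbasis \<alpha>) = 0"
  using mean_wshift_translate[of k "wbasis \<alpha>"]
  by (simp add: wshift_wbasis_translate assms mean_scaleC)

text \<open>The conditional expectation that forgets the first n coordinates. Built one coordinate
  at a time, it uses only sums, real multiples and single translations, under which an invariant
  subspace is stable.\<close>

fun avg :: "nat \<Rightarrow> L2 \<Rightarrow> L2" where
  "avg 0 u = u"
| "avg (Suc n) u = (1 / 2) *\<^sub>R (avg n u + wshift (\<lambda>_. 1) (\<delta> (pos_of_nat (Suc n))) (avg n u))"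

lemma clinear_avg: "clinear (avg n)"
proof (induction n)
  case 0
  show ?case by (simp add: clinear_def)
next
  case (Suc n)
  have T: "clinear (wshift (\<lambda>_. 1) a)" for a
    by (intro clinear_wshift unimodular_const) simp
  show ?case
    unfolding clinear_def
    by (simp add: clinear_add[OF Suc] clinear_add[OF T] clinear_scaleC[OF Suc] clinear_scaleC[OF T]
        scaleC_add_right scaleR_scaleC scaleC_scaleC mult.commute)
qed

lemma norm_avg: "norm (avg n u) \<le> norm u"
proof (induction n)
  case (Suc n)
  have "norm (avg (Suc n) u) \<le> (norm (avg n u) + norm (avg n u)) / 2"
    using norm_triangle_ineq[of "avg n u" "wshift (\<lambda>_. 1) (\<delta> (pos_of_nat (Suc n))) (avg n u)"]
    by (simp add: norm_wshift unimodular_const)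
  then show ?case using Suc by simp
qed simp

lemma avg_wbasis:
  assumes "\<alpha> \<in> \<Delta>"
  shows "avg n (wbasis \<alpha>) = (if \<exists>k. nat_of_pos k \<le> n \<and> \<alpha> k = 1 then 0 else wbasis \<alpha>)"
proof (induction n)
  case 0
  have "\<not> (\<exists>k. nat_of_pos k \<le> 0 \<and> \<alpha> k = 1)"
    using nat_of_pos_ge_1 by (metis not_one_le_zero le_zero_eq)
  then show ?case by (simp only: avg.simps if_False)
next
  case (Suc n)
  define k where "k = pos_of_nat (Suc n)"
  have k: "nat_of_pos k = Suc n" by (simp add: k_def pos_of_nat_inverse)
  then have ex: "(\<exists>l. nat_of_pos l \<le> Suc n \<and> \<alpha> l = 1) \<longleftrightarrow> (\<exists>l. nat_of_pos l \<le> n \<and> \<alpha> l = 1) \<or> \<alpha> k = 1"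
    by (metis le_Suc_eq nat_of_pos_inject)
  have T: "clinear (wshift (\<lambda>_. 1) (\<delta> k))"
    by (intro clinear_wshift unimodular_const) simp
  have zero: "wshift (\<lambda>_. 1) (\<delta> k) 0 = 0"
    using clinear_diff[OF T, of 0 0] by simp
  have m: "(- 1) *\<^sub>C wbasis \<alpha> = - wbasis \<alpha>"
    using scaleR_scaleC[of "- 1" "wbasis \<alpha>"] by simp
  show ?case
    unfolding avg.simps Suc ex k_def[symmetric]
    \<comment> \<open>If \<alpha> has a 1 at the new position, the two halves cancel; otherwise they
      add up to the same Walsh vector.\<close>
    by (cases "\<exists>l. nat_of_pos l \<le> n \<and> \<alpha> l = 1"; cases "\<alpha> k")
      (simp_all only: if_True if_False simp_thms zero wshift_wbasis_translate[OF assms] bsgn_simps m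
        scaleC_one zero_neq_one add_0_left scaleR_zero_right add.right_inverse scaleR_half_double)
qed

text \<open>The uniform bound \<open>K\<close> lets one fixed approximant \<open>f i\<close> of u
  serve for all n: it contributes less than r / 2, and \<open>B n (f i)\<close> is below r / 2 for
  large n.\<close>

lemma closed_tendsto_zero:
  fixes B :: "nat \<Rightarrow> 'a::real_normed_vector \<Rightarrow> 'b::real_normed_vector"
  assumes diff: "\<And>n u v. B n (u - v) = B n u - B n v" and bound: "\<And>n u. norm (B n u) \<le> K * norm u"
  shows "closed {u. (\<lambda>n. B n u) \<longlonglongrightarrow> 0}"
  unfolding closed_sequential_limits
proof (intro allI impI, elim conjE)
  fix f u assume f: "\<forall>i. f i \<in> {u. (\<lambda>n. B n u) \<longlonglongrightarrow> 0}" and u: "f \<longlonglongrightarrow> u"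
  have "(\<lambda>n. B n u) \<longlonglongrightarrow> 0"
  proof (rule LIMSEQ_I)
    fix r :: real assume r: "0 < r"
    have "(\<lambda>i. norm (u - f i)) \<longlonglongrightarrow> 0"
      using tendsto_norm[OF tendsto_diff[OF tendsto_const[of u] u]] by simp
    then have "(\<lambda>i. K * norm (u - f i)) \<longlonglongrightarrow> 0"
      by (rule tendsto_mult_right_zero)
    then have "\<forall>\<^sub>F i in sequentially. K * norm (u - f i) < r / 2"
      using r by (intro order_tendstoD) auto
    then obtain i where i: "K * norm (u - f i) < r / 2"
      using eventually_happens'[OF sequentially_bot] by blast
    obtain N where N: "norm (B n (f i) - 0) < r / 2" if "N \<le> n" for n
      using LIMSEQ_D[of "\<lambda>n. B n (f i)" 0 "r / 2"] f r by auto
    have "norm (B n u - 0) < r" if "N \<le> n" for n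
    proof -
      have "norm (B n u) \<le> norm (B n (u - f i)) + norm (B n (f i))"
        using norm_triangle_ineq[of "B n (u - f i)" "B n (f i)"] by (simp add: diff)
      then show ?thesis using bound[of n "u - f i"] i N[OF that] by simp
    qed
    then show "\<exists>N. \<forall>n\<ge>N. norm (B n u - 0) < r" by blast
  qed
  then show "u \<in> {u. (\<lambda>n. B n u) \<longlonglongrightarrow> 0}" by simp
qed

lemma tendsto_scaleC_zero:
  fixes f :: "nat \<Rightarrow> 'v::complex_normed_vector"
  assumes "f \<longlonglongrightarrow> 0"
  shows "(\<lambda>n. a *\<^sub>C f n) \<longlonglongrightarrow> 0"
proof (rule tendsto_norm_zero_cancel)
  show "(\<lambda>n. norm (a *\<^sub>C f n)) \<longlonglongrightarrow> 0"
    unfolding norm_scaleC by (intro tendsto_mult_right_zero tendsto_norm_zero assms)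
qed

lemma avg_tendsto_mean: "(\<lambda>n. avg n u) \<longlonglongrightarrow> mean u *\<^sub>C wbasis 0"
proof -
  define B where "B n u = avg n u - mean u *\<^sub>C wbasis 0" for n u
  have B_add: "B n (u + v) = B n u + B n v" for n u v
    by (simp add: B_def clinear_add[OF clinear_avg] mean_add scaleC_add_left)
  have B_scale: "B n (a *\<^sub>C u) = a *\<^sub>C B n u" for n a u
  proof -
    have "clinear (\<lambda>v::L2. a *\<^sub>C v)"
      by (simp add: clinear_def scaleC_add_right scaleC_scaleC mult.commute)
    from clinear_diff[OF this] show ?thesis
      by (simp add: B_def clinear_scaleC[OF clinear_avg] mean_scaleC scaleC_scaleC)
  qed
  have B_diff: "B n (u - v) = B n u - B n v" for n u v
    using B_add[of n "u - v" v] by simp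
  \<comment> \<open>The 3 adds 1 for the contraction \<open>avg n\<close> and 2 for the crude bound
    on the mean.\<close>
  have B_norm: "norm (B n u) \<le> 3 * norm u" for n u
  proof -
    have "norm (B n u) \<le> norm (avg n u) + cmod (mean u) * norm (wbasis 0)"
      unfolding B_def norm_scaleC[symmetric] by (rule norm_triangle_ineq4)
    then show ?thesis
      using norm_avg[of n u] cmod_mean[of u] norm_wbasis[OF zero_in_Delta] by simp
  qed
  \<comment> \<open>The vectors with vanishing limit error form a closed complex subspace, so the
    claim need be checked on Walsh functions only.\<close>
  define D where "D = {u. (\<lambda>n. B n u) \<longlonglongrightarrow> 0}"
  have "csubspace D"
    unfolding csubspace_def D_def mem_Collect_eq
  proof (intro conjI ballI allI, simp_all only: mem_Collect_eq)
    have "B n 0 = 0" for n using B_diff[of n 0 0] by simp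
    then show "(\<lambda>n. B n 0) \<longlonglongrightarrow> 0" by simp
    show "(\<lambda>n. B n (u + v)) \<longlonglongrightarrow> 0" if "(\<lambda>n. B n u) \<longlonglongrightarrow> 0" "(\<lambda>n. B n v) \<longlonglongrightarrow> 0" for u v
      unfolding B_add by (rule tendsto_add_zero[OF that])
    show "(\<lambda>n. B n (a *\<^sub>C u)) \<longlonglongrightarrow> 0" if "(\<lambda>n. B n u) \<longlonglongrightarrow> 0" for a u
      unfolding B_scale by (rule tendsto_scaleC_zero[OF that])
  qed
  moreover have "closed D"
    unfolding D_def by (rule closed_tendsto_zero[OF B_diff B_norm])
  moreover have "abs_L2 (walsh \<alpha>) \<in> D" if \<alpha>: "\<alpha> \<in> \<Delta>" for \<alpha>
  proof -
    \<comment> \<open>On Walsh functions the error is eventually exactly 0: for nonzero \<alpha>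
      both terms vanish once a coordinate of its support is averaged, and for \<alpha> = 0 they
      coincide.\<close>
    have "\<forall>\<^sub>F n in sequentially. B n (wbasis \<alpha>) = 0"
    proof (cases "\<exists>k. \<alpha> k = 1")
      case True
      then obtain k where k: "\<alpha> k = 1" by blast
      have "B n (wbasis \<alpha>) = 0" if "nat_of_pos k \<le> n" for n
      proof -
        have "avg n (wbasis \<alpha>) = 0" using avg_wbasis[OF \<alpha>, of n] k that by metis
        moreover have "0 *\<^sub>C wbasis 0 = 0" using scaleR_scaleC[of 0 "wbasis 0"] by simp
        ultimately show ?thesis
          by (simp only: B_def mean_wbasis[OF \<alpha> k] diff_self)
      qed
      then show ?thesis by (auto simp: eventually_sequentially)
    next
      case False
      then have "\<alpha> k = 0" for k by (cases "\<alpha> k") auto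
      then have "\<alpha> = 0" by (intro ext) (simp only: zero_fun_apply)
      moreover have "avg n (wbasis 0) = wbasis 0" for n
        using avg_wbasis[OF zero_in_Delta, of n] by simp
      ultimately show ?thesis
        by (simp add: B_def mean_wbasis_0 scaleC_one)
    qed
    then show ?thesis
      unfolding D_def mem_Collect_eq wbasis_def by (rule tendsto_eventually)
  qed
  ultimately have "D = UNIV" by (rule closed_csubspace_Walsh)
  then have "(\<lambda>n. B n u) \<longlonglongrightarrow> 0" by (auto simp: D_def)
  then show ?thesis unfolding B_def by (rule LIM_zero_cancel)
qed

text \<open>These means are the Walsh coefficients of u. If all vanished, u would be orthogonal to a
  dense span and hence to itself.\<close>

lemma ex_mean_wshift_nonzero:
  assumes "u \<noteq> 0"
  shows "\<exists>\<alpha>\<in>\<Delta>. mean (wshift (walsh \<alpha>) 0 u) \<noteq> 0"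
proof (rule ccontr)
  assume "\<not> ?thesis"
  then have *: "mean (wshift (walsh \<alpha>) 0 u) = 0" if "\<alpha> \<in> \<Delta>" for \<alpha> using that by blast
  \<comment> \<open>Real orthogonality to both u and \<open>\<i> *\<^sub>C u\<close> is Hermitian
    orthogonality to u, so that D is a complex subspace.\<close>
  define D where "D = {v. inner v u = 0} \<inter> {v. inner v (\<i> *\<^sub>C u) = 0}"
  have "closed D"
    unfolding D_def by (intro closed_Int closed_Collect_eq continuous_intros)
  moreover have "csubspace D"
  proof -
    have "inner (a *\<^sub>C v) u = Re a * inner v u - Im a * inner v (\<i> *\<^sub>C u)"
      "inner (a *\<^sub>C v) (\<i> *\<^sub>C u) = Re a * inner v (\<i> *\<^sub>C u) + Im a * inner v u" for a v
      by (simp_all only: scaleC_Complex[of a v] inner_add_left inner_scaleR_left inner_ii_ii)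
        (simp_all add: inner_ii_left)
    then show ?thesis
      unfolding csubspace_def D_def by (simp add: inner_add_left)
  qed
  moreover have "abs_L2 (walsh \<alpha>) \<in> D" if \<alpha>: "\<alpha> \<in> \<Delta>" for \<alpha>
  proof -
    let ?M = "wshift (walsh \<alpha>) 0"
    note w = unimodular_walsh[OF \<alpha>]
    have "?M (wbasis \<alpha>) = wbasis 0"
      by (simp only: wshift_wbasis_mult[OF \<alpha> \<alpha>] X_add_self)
    \<comment> \<open>The isometry \<open>?M\<close> carries \<open>wbasis \<alpha>\<close> to
      \<open>wbasis 0\<close>, which turns the coefficient at \<alpha> into a mean.\<close>
    then have "inner (wbasis \<alpha>) u = inner (wbasis 0) (?M u)"
      "inner (\<i> *\<^sub>C wbasis \<alpha>) u = inner (\<i> *\<^sub>C wbasis 0) (?M u)"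
      using inner_wshift[OF w, of 0 "wbasis \<alpha>" u] inner_wshift[OF w, of 0 "\<i> *\<^sub>C wbasis \<alpha>" u]
      by (simp_all only: clinear_scaleC[OF clinear_wshift[OF w]])
    then show ?thesis
      using *[OF \<alpha>] by (simp add: D_def wbasis_def mean_def complex_eq_iff inner_ii_left)
  qed
  ultimately have "D = UNIV" by (intro closed_csubspace_Walsh)
  then have "u \<in> D" by blast
  then have "inner u u = 0" by (simp add: D_def)
  with assms show False by simp
qed

lemma irreducible_J_op:
  assumes \<gamma>: "\<gamma> \<in> \<Gamma>"
  shows "irreducible_over_C (J_op \<gamma>) (J'_op \<gamma>)"
  unfolding irreducible_over_C_def
proof (intro allI impI)
  fix W assume "csubspace W \<and> closed W \<and> (\<forall>k. J_op \<gamma> k ` W \<subseteq> W \<and> J'_op \<gamma> k ` W \<subseteq> W)"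
  then have W: "csubspace W" "closed W"
    and J: "\<And>k u. u \<in> W \<Longrightarrow> J_op \<gamma> k u \<in> W" and J': "\<And>k u. u \<in> W \<Longrightarrow> J'_op \<gamma> k u \<in> W"
    by auto
  note D = sigma_add_row_in_Delta[OF \<gamma>]
  have z: "cmod (- \<i>) = 1" "cmod 1 = 1" by simp_all
  have diag: "\<gamma> k k = 0" for k using \<gamma> by (simp add: \<Gamma>_def)
  have delta: "wshift (walsh (\<delta> k)) 0 u \<in> W" if "u \<in> W" for k u
  proof -
    let ?n = "nat_of_pos k"
    have "\<sigma> ?n = \<sigma> (?n - 1) + \<delta> k"
    proof (rule ext)
      fix j
      consider "nat_of_pos j \<le> ?n - 1" | "j = k" | "\<not> nat_of_pos j \<le> ?n" "j \<noteq> k" "\<not> nat_of_pos j \<le> ?n - 1"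
        using nat_of_pos_inject[of j k] by linarith
      then show "\<sigma> ?n j = (\<sigma> (?n - 1) + \<delta> k) j"
        using nat_of_pos_ge_1[of k]
        by cases (auto simp: plus_fun_apply sigma_apply \<delta>_def)
    qed
    then have "walsh (\<sigma> ?n + \<gamma> k) x = walsh (\<sigma> (?n - 1) + \<gamma> k) x * walsh (\<delta> k) x" for x
      by (simp only: walsh_add_left sigma_in_Delta row_in_Delta[OF \<gamma>] delta_in_Delta add_in_Delta ac_simps)
    \<comment> \<open>The translations cancel and the weights multiply to the Walsh function of
      \<delta> k. The scalar is \<open>- \<i>\<close> times the sign -1 that the weight of
      \<open>J'_op\<close> acquires under translation by \<delta> k.\<close>
    then have "J_op \<gamma> k (J'_op \<gamma> k u) = wshift (\<lambda>x. \<i> * walsh (\<delta> k) x) 0 u"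
      unfolding J_op_eq J'_op_eq wshift_walsh_wshift_walsh[OF z D D] bsgn_sigma_add_row X_add_self diag
      by (simp add: mult.assoc[symmetric])
    then have "(- \<i>) *\<^sub>C J_op \<gamma> k (J'_op \<gamma> k u) = wshift (walsh (\<delta> k)) 0 u"
      by (simp add: scaleC_wshift unimodular_walsh_mult delta_in_Delta mult.assoc[symmetric])
    then show ?thesis
      using csubspace_scaleC[OF W(1) J[OF J'[OF that]], of "- \<i>" k k] by simp
  qed
  have mult: "wshift (walsh \<alpha>) 0 u \<in> W" if "\<alpha> \<in> \<Delta>" "u \<in> W" for \<alpha> u
    using that
  proof (induction \<alpha> rule: Delta_induct)
    case zero
    have "walsh 0 = (\<lambda>_. 1)" by (rule ext) (rule walsh_zero)
    then show ?case using zero by (simp only: wshift_id)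
  next
    case (add_delta \<alpha> k)
    have "wshift (walsh (\<delta> k)) 0 (wshift (walsh \<alpha>) 0 u) = wshift (walsh (\<delta> k + \<alpha>)) 0 u"
      unfolding ext[of "walsh (\<delta> k + \<alpha>)", OF walsh_add_left[OF delta_in_Delta add_delta.hyps]]
      by (simp only: wshift_wshift unimodular_walsh delta_in_Delta add_delta.hyps add_0_right)
    then show ?case using delta[OF add_delta.IH[OF add_delta.prems], of k] by (simp only:)
  qed
  have translate: "wshift (\<lambda>_. 1) (\<delta> k) u \<in> W" if "u \<in> W" for k u
  proof -
    \<comment> \<open>Multiplying \<open>J'_op\<close> by its own weight, whose square is 1, leaves
      the bare translation.\<close>
    have "wshift (walsh (\<sigma> (nat_of_pos k) + \<gamma> k)) 0 (J'_op \<gamma> k u) = wshift (\<lambda>_. 1) (\<delta> k) u"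
      unfolding J'_op_eq mult_1
      by (simp only: wshift_wshift unimodular_walsh D add_0_right add_0_left walsh_square)
    then show ?thesis using mult[OF D J'[OF that]] by metis
  qed
  have avg: "avg n u \<in> W" if "u \<in> W" for n u
    using that by (induction n) (auto intro!: csubspace_scaleR csubspace_add W translate)
  show "W = {0} \<or> W = UNIV"
  proof (cases "W \<subseteq> {0}")
    case True
    then show ?thesis using W(1) by (auto simp: csubspace_def)
  next
    case False
    then obtain u where u: "u \<in> W" "u \<noteq> 0" by auto
    then obtain \<alpha> where \<alpha>: "\<alpha> \<in> \<Delta>" "mean (wshift (walsh \<alpha>) 0 u) \<noteq> 0"
      using ex_mean_wshift_nonzero by blast
    let ?v = "wshift (walsh \<alpha>) 0 u"
    \<comment> \<open>Closedness of W enters here: the averages of \<open>?v\<close> lie in W and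
      converge to this constant function.\<close>
    have "mean ?v *\<^sub>C wbasis 0 \<in> W"
      by (rule closed_sequentially[OF W(2) avg avg_tendsto_mean]) (rule mult[OF \<alpha>(1) u(1)])
    from csubspace_scaleC[OF W(1) this, of "inverse (mean ?v)"] have "wbasis 0 \<in> W"
      using \<alpha>(2) by (simp add: scaleC_scaleC scaleC_one)
    then have "abs_L2 (walsh \<beta>) \<in> W" if "\<beta> \<in> \<Delta>" for \<beta>
      using mult[OF that, of "wbasis 0"] wshift_wbasis_mult[OF that zero_in_Delta]
      by (simp only: wbasis_def add_0_right)
    then show ?thesis using closed_csubspace_Walsh[OF W] by blast
  qed
qed

theorem theorem3p15:
  fixes \<gamma> :: "pos \<Rightarrow> pos \<Rightarrow> bit"
  assumes "\<gamma> \<in> \<Gamma>"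
  shows "(\<forall>k x. cnj (c_mult \<gamma> k x) = c_mult \<gamma> k (x + \<delta> k)) \<and>
    (\<forall>k l x. c_mult \<gamma> k x * c_mult \<gamma> l (x + \<delta> k) = c_mult \<gamma> l x * c_mult \<gamma> k (x + \<delta> l)) \<and>
    spinor_rep (J_op \<gamma>) (J'_op \<gamma>) \<and>
    irreducible_over_C (J_op \<gamma>) (J'_op \<gamma>) \<and>
    (\<gamma> \<in> \<Gamma>\<^sub>1 \<longrightarrow>
      real_type (J_op \<gamma>) (J'_op \<gamma>) \<and>
      (\<forall>k x. cnj (c_mult \<gamma> k x) = (- 1) ^ nat_of_pos k * c_mult \<gamma> k (check x)) \<and>
      real_structure (J_op \<gamma>) (J'_op \<gamma>) S_op \<and>
      invariant_real_form S_op = L2_real) \<and>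
    (\<gamma> \<in> \<Gamma>\<^sub>m\<^sub>1 \<longrightarrow>
      quaternionic_type (J_op \<gamma>) (J'_op \<gamma>) \<and>
      (\<forall>x. cnj (c_mult \<gamma> 1 x) = c_mult \<gamma> 1 (check x)) \<and>
      (\<forall>k x. nat_of_pos k \<ge> 2 \<longrightarrow>
        cnj (c_mult \<gamma> k x) = (- 1) ^ nat_of_pos k * c_mult \<gamma> k (check x)) \<and>
      quaternionic_structure (J_op \<gamma>) (J'_op \<gamma>) Q_op)"
proof (intro conjI impI allI)
  \<comment> \<open>All pointwise identities for \<open>c_mult\<close> follow from this
    factorization, the real values of Walsh functions, and the symmetry, zero diagonal and row
    parities of \<gamma>.\<close>
  have c: "c_mult \<gamma> k (x + y) = c_mult \<gamma> k x * walsh (\<gamma> k) y" for k x y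
    unfolding c_mult_def by (rule walsh_add_right[OF row_in_Delta[OF assms]])
  have cnj: "cnj (c_mult \<gamma> k x) = c_mult \<gamma> k x" for k x
    by (simp add: c_mult_def)
  show "cnj (c_mult \<gamma> k x) = c_mult \<gamma> k (x + \<delta> k)" for k x
    using assms unfolding c cnj walsh_delta_right by (simp add: \<Gamma>_def)
  show "c_mult \<gamma> k x * c_mult \<gamma> l (x + \<delta> k) = c_mult \<gamma> l x * c_mult \<gamma> k (x + \<delta> l)" for k l x
  proof -
    have "\<gamma> k l = \<gamma> l k" using assms by (simp add: \<Gamma>_def)
    then show ?thesis unfolding c walsh_delta_right by simp
  qed
  show "spinor_rep (J_op \<gamma>) (J'_op \<gamma>)" by (rule spinor_rep_J_op[OF assms])
  show "irreducible_over_C (J_op \<gamma>) (J'_op \<gamma>)" by (rule irreducible_J_op[OF assms])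
  \<comment> \<open>The exponent n is left free so that the even first row in the quaternionic case
    is covered with n = 0.\<close>
  have check: "cnj (c_mult \<gamma> k x) = (- 1) ^ n * c_mult \<gamma> k (check x)"
    if "[card {j. \<gamma> k j = 1} = n] (mod 2)" for k n x
    unfolding check_def c cnj walsh_ones_cong[OF that] by (simp flip: power_add)
  {
    assume \<gamma>: "\<gamma> \<in> \<Gamma>\<^sub>1"
    show "real_structure (J_op \<gamma>) (J'_op \<gamma>) S_op" by (rule real_structure_S_op[OF \<gamma>])
    then show "real_type (J_op \<gamma>) (J'_op \<gamma>)" unfolding real_type_def by blast
    show "cnj (c_mult \<gamma> k x) = (- 1) ^ nat_of_pos k * c_mult \<gamma> k (check x)" for k x
      using \<gamma> by (intro check) (simp add: \<Gamma>\<^sub>1_def)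
    show "invariant_real_form S_op = L2_real" by (rule invariant_real_form_S_op)
  next
    assume \<gamma>: "\<gamma> \<in> \<Gamma>\<^sub>m\<^sub>1"
    show "quaternionic_structure (J_op \<gamma>) (J'_op \<gamma>) Q_op" by (rule quaternionic_structure_Q_op[OF \<gamma>])
    then show "quaternionic_type (J_op \<gamma>) (J'_op \<gamma>)" unfolding quaternionic_type_def by blast
    show "cnj (c_mult \<gamma> 1 x) = c_mult \<gamma> 1 (check x)" for x
      using \<gamma> check[of 1 0 x] by (simp add: \<Gamma>\<^sub>m\<^sub>1_def)
    show "cnj (c_mult \<gamma> k x) = (- 1) ^ nat_of_pos k * c_mult \<gamma> k (check x)"
      if "nat_of_pos k \<ge> 2" for k x
      using \<gamma> that by (intro check) (simp add: \<Gamma>\<^sub>m\<^sub>1_def)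
  }
qed

end
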